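(* Let $\mathfrak g=W_{\geq-1}$ or $W$ or $W_{\geq1}$, and let $x\in\Bbbk$; if $\mathfrak g=W$ or $W_{\geq1}$ assume additionally that $x\neq0$. Fix $n\in\mathbb{Z}_{\ge0}$ and $\beta_0,\dots,\beta_n\in\Bbbk$ with $\beta_n\neq0$, and set $\chi=\chi_{x;\beta_0,\dots,\beta_n}\in\mathfrak g^*$. Write $e_i^*=e_i(x)^*$. (a) If $n$ is even then $\mathrm{DLoc}_x^{\leq n}\chi=\mathrm{DLoc}_x^{\leq n}e_{n-1}^*$, and $\dim \mathrm{DLoc}_x^{\leq n}\chi=n+1$. (b) If $n$ is odd and $n>1$ then there is $\beta\in\Bbbk$ such that $\mathrm{DLoc}_x^{\leq n}\chi=\mathrm{DLoc}_x^{\leq n}(e_{n-1}^*+\beta e_k^* )$, where $k=\frac{n-1}{2}$. We have $\dim\mathrm{DLoc}_x^{\leq n}\chi=n$. (b$'$) If $n=1$ then $\mathrm{DLoc}_x^{\leq n}\chi=\mathrm{DLoc}_x^{\leq n}(\beta_1e_0^* )$, and $\dim\mathrm{DLoc}_x^{\leq n}\chi=1$. (c) Let $\beta_1,\beta_2\in\Bbbk$ and $k\in\mathbb{Z}_{\geq1}$, and let $n\ge 2k+1$. Then $\mathrm{DLoc}_x^{\leq n}(e_{2k}^*+\beta_1e_k^* )=\mathrm{DLoc}_x^{\leq n}(e_{2k}^*+\beta_2e_k^* )$ if and only if $\beta_1=\pm\beta_2$. (c$'$) Let $\beta_1,\beta_2\in\Bbbk$. Then $\mathrm{DLoc}_x^{\leq1}(\beta_1e_0^*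 )=\mathrm{DLoc}_x^{\leq1}(\beta_2e_0^* )$ if and only if $\beta_1=\beta_2$.
   Context: $\Bbbk$ is an uncountable algebraically closed field of characteristic $0$; $\partial=d/dt$. $W=\Bbbk[t,t^{-1}]\partial$ with $[f\partial,g\partial]=(fg'-f'g)\partial$; $W_{\geq-1}=\Bbbk[t]\partial$ and $W_{\geq1}=t^2\Bbbk[t]\partial$ are subalgebras. For $x,\beta_0,\dots,\beta_n\in\Bbbk$, $\chi_{x;\beta_0,\dots,\beta_n}$ denotes the functional $f\partial\mapsto\beta_0f(x)+\beta_1f'(x)+\dots+\beta_nf^{(n)}(x)$. $\mathrm{Loc}_x^{\leq n}$ is the space of all $\chi_{x;\beta_0,\dots,\beta_n}$ ($\beta_i\in\Bbbk$ arbitrary). For $i\geq-1$, $e_i(x)^*$ is the functional $f\partial\mapsto \frac{f^{(i+1)}(x)}{(i+1)!}$, so that $e_i(x)^*((t-x)^{j+1}\partial)=\delta_{ij}$. These formulas also define functionals on $\Bbbk[[t-x]]\partial$. For $s\in\Bbbk[[t-x]]$ with $s(x)=x$ and $s'(x)\neq0$, let $\mathrm{End}_{t\to s}$ be the automorphism of $\Bbbk[[t-x]]\partial$ given by $t\mapsto s$, $\partial\mapsto\frac1{s'}\partial$, i.e. $f\partial\mapsto\frac{f(s)}{s'}\partial$. These automorphisms form a group $\mathrm{DLoc}_x$, which acts by the dual action on $(\Bbbk[[t-x]]\partial)^*$ and preserves $\mathrm{Loc}_x^{\leq n}$. $\mathrm{DLoc}_x^{\leq n}$ denotes the image of $\mathrm{DLoc}_x$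 in the group of linear automorphisms of the finite-dimensional space $\mathrm{Loc}_x^{\leq n}$; it is a finite-dimensional connected solvable algebraic group, and $\mathrm{DLoc}_x^{\le n}\nu$ is the orbit of $\nu\in\mathrm{Loc}_x^{\le n}$. *)

theory Defs
  imports
    "HOL-Computational_Algebra.Computational_Algebra"
    "HOL-Analysis.Abstract_Topology"
    "HOL-Library.Extended_Nat"
    "HOL-Library.Countable_Set"
begin

(* A vector field f d/dt is represented by its coefficient f. Laurent polynomials in t are
   Laurent series with finite support. *)

definition W :: "'a::field fls set" where
  "W = {f. finite {i. fls_nth f i \<noteq> 0}}"

(* W_ge m is spanned by the fields t^(i+1) d/dt with i >= m; so W_ge (-1) = k[t] d/dt and
   W_ge 1 = t^2 k[t] d/dt. *)
definition W_ge :: "int \<Rightarrow> 'a::field fls set" where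
  "W_ge m = {f \<in> W. \<forall>i\<le>m. fls_nth f i = 0}"

(* The value f(x); meaningful if f is in W and x is nonzero, or if f is a polynomial. *)
definition leval :: "'a::field fls \<Rightarrow> 'a \<Rightarrow> 'a" where
  "leval f x = (\<Sum>i | fls_nth f i \<noteq> 0. fls_nth f i * x powi i)"

(* The i-th derivative of f at x. *)
definition lderiv_at :: "nat \<Rightarrow> 'a::field fls \<Rightarrow> 'a \<Rightarrow> 'a" where
  "lderiv_at i f x = leval ((fls_deriv ^^ i) f) x"

(* Functionals on a space \<gg> of Laurent polynomials are represented by functions that vanish
   outside \<gg>; the vector space operations on them are then pointwise. *)

definition chi :: "'a::field fls set \<Rightarrow> 'a \<Rightarrow> nat \<Rightarrow> (nat \<Rightarrow> 'a) \<Rightarrow> ('a fls \<Rightarrow> 'a)" where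
  "chi \<gg> x n \<beta> = (\<lambda>f. if f \<in> \<gg> then \<Sum>i\<le>n. \<beta> i * lderiv_at i f x else 0)"

(* Only used for i >= -1. *)
definition e_star :: "'a::field_char_0 fls set \<Rightarrow> 'a \<Rightarrow> int \<Rightarrow> ('a fls \<Rightarrow> 'a)" where
  "e_star \<gg> x i =
     (\<lambda>f. if f \<in> \<gg> then lderiv_at (nat (i + 1)) f x / fact (nat (i + 1)) else 0)"

definition Loc :: "'a::field fls set \<Rightarrow> 'a \<Rightarrow> nat \<Rightarrow> ('a fls \<Rightarrow> 'a) set" where
  "Loc \<gg> x n = range (chi \<gg> x n)"

(* An element of k[[t-x]] d/dt is represented by a formal power series whose variable stands for
   t-x; in particular evaluation at x is the constant coefficient, fps_deriv is d/dt, and the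
   formulas for local functionals do not mention x. *)

definition fps_chi :: "nat \<Rightarrow> (nat \<Rightarrow> 'a::field) \<Rightarrow> ('a fps \<Rightarrow> 'a)" where
  "fps_chi n \<beta> = (\<lambda>f. \<Sum>i\<le>n. \<beta> i * fps_nth ((fps_deriv ^^ i) f) 0)"

definition fps_Loc :: "nat \<Rightarrow> ('a::field fps \<Rightarrow> 'a) set" where
  "fps_Loc n = range (fps_chi n)"

(* f d/dt is sent to (f(s) / s') d/dt. Since f is a series in t-x, f(s) is the composition of f
   with s - x. *)
definition End_subst :: "'a::field \<Rightarrow> 'a fps \<Rightarrow> ('a fps \<Rightarrow> 'a fps)" where
  "End_subst x s = (\<lambda>f. fps_compose f (s - fps_const x) * inverse (fps_deriv s))"

(* fps_nth s 0 and fps_nth s 1 are s(x) and s'(x). *)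
definition DLoc :: "'a::field \<Rightarrow> ('a fps \<Rightarrow> 'a fps) set" where
  "DLoc x = {End_subst x s | s. fps_nth s 0 = x \<and> fps_nth s 1 \<noteq> 0}"

definition dual_act :: "('b \<Rightarrow> 'b) \<Rightarrow> ('b \<Rightarrow> 'a) \<Rightarrow> ('b \<Rightarrow> 'a)" where
  "dual_act g \<phi> = \<phi> \<circ> inv g"

definition DLoc_le :: "'a::field \<Rightarrow> nat \<Rightarrow> (('a fps \<Rightarrow> 'a) \<Rightarrow> ('a fps \<Rightarrow> 'a)) set" where
  "DLoc_le x n = (\<lambda>g. restrict (dual_act g) (fps_Loc n)) ` DLoc x"

(* The embedding of \<gg> into k[[t-x]] d/dt, and restriction of functionals along it. *)

definition taylor :: "'a::field_char_0 \<Rightarrow> 'a fls \<Rightarrow> 'a fps" where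
  "taylor x f = Abs_fps (\<lambda>i. lderiv_at i f x / fact i)"

definition pullback :: "'a::field_char_0 fls set \<Rightarrow> 'a \<Rightarrow> ('a fps \<Rightarrow> 'a) \<Rightarrow> ('a fls \<Rightarrow> 'a)" where
  "pullback \<gg> x \<phi> = (\<lambda>f. if f \<in> \<gg> then \<phi> (taylor x f) else 0)"

lemma pullback_fps_chi: "pullback \<gg> x (fps_chi n \<beta>) = chi \<gg> x n \<beta>"
  by (simp add: pullback_def chi_def fps_chi_def taylor_def fps_0th_higher_deriv fun_eq_iff
      cong: if_cong)

lemma Loc_eq_pullback: "Loc \<gg> x n = pullback \<gg> x ` fps_Loc n"
  by (auto simp: Loc_def fps_Loc_def pullback_fps_chi image_iff)

(* The orbit of \<nu> in Loc \<gg> x n, where Loc \<gg> x n is identified by pullback with the space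
   fps_Loc n on which the group acts. *)
definition orbit ::
    "'a::field_char_0 fls set \<Rightarrow> 'a \<Rightarrow> nat \<Rightarrow> ('a fls \<Rightarrow> 'a) \<Rightarrow> ('a fls \<Rightarrow> 'a) set" where
  "orbit \<gg> x n \<nu> =
     {pullback \<gg> x (A \<phi>) | A \<phi>. A \<in> DLoc_le x n \<and> \<phi> \<in> fps_Loc n \<and> pullback \<gg> x \<phi> = \<nu>}"

(* The Zariski topology of a finite-dimensional space V of k-valued functions with pointwise
   operations: closed sets are common zero sets of polynomial functions, and polynomial functions
   are generated by the linear functionals on V. *)

definition linear_functional_on :: "('b \<Rightarrow> 'a::field) set \<Rightarrow> (('b \<Rightarrow> 'a) \<Rightarrow> 'a) \<Rightarrow> bool" where
  "linear_functional_on V l \<longleftrightarrow>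
     (\<forall>u\<in>V. \<forall>v\<in>V. l (\<lambda>y. u y + v y) = l u + l v) \<and>
     (\<forall>c. \<forall>u\<in>V. l (\<lambda>y. c * u y) = c * l u)"

inductive_set polynomial_functions :: "('b \<Rightarrow> 'a::field) set \<Rightarrow> (('b \<Rightarrow> 'a) \<Rightarrow> 'a) set"
  for V where
  const: "(\<lambda>_. c) \<in> polynomial_functions V"
| linear: "linear_functional_on V l \<Longrightarrow> l \<in> polynomial_functions V"
| add: "p \<in> polynomial_functions V \<Longrightarrow> q \<in> polynomial_functions V \<Longrightarrow>
    (\<lambda>v. p v + q v) \<in> polynomial_functions V"
| mult: "p \<in> polynomial_functions V \<Longrightarrow> q \<in> polynomial_functions V \<Longrightarrow>
    (\<lambda>v. p v * q v) \<in> polynomial_functions V"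

definition zero_locus :: "('b \<Rightarrow> 'a::field) set \<Rightarrow> (('b \<Rightarrow> 'a) \<Rightarrow> 'a) set \<Rightarrow> ('b \<Rightarrow> 'a) set" where
  "zero_locus V F = {v \<in> V. \<forall>p\<in>F. p v = 0}"

definition zariski :: "('b \<Rightarrow> 'a::field) set \<Rightarrow> ('b \<Rightarrow> 'a) topology" where
  "zariski V = topology (\<lambda>U. \<exists>F \<subseteq> polynomial_functions V. U = V - zero_locus V F)"

lemma istopology_zariski:
  "istopology (\<lambda>U. \<exists>F \<subseteq> polynomial_functions V. U = V - zero_locus V F)"
  unfolding istopology_def
proof (intro conjI allI impI)
  fix S T
  assume "\<exists>F \<subseteq> polynomial_functions V. S = V - zero_locus V F"
    and "\<exists>F \<subseteq> polynomial_functions V. T = V - zero_locus V F"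
  then obtain F G where F: "F \<subseteq> polynomial_functions V" "S = V - zero_locus V F"
    and G: "G \<subseteq> polynomial_functions V" "T = V - zero_locus V G" by blast
  let ?H = "{\<lambda>v. p v * q v | p q. p \<in> F \<and> q \<in> G}"
  have "?H \<subseteq> polynomial_functions V"
    using F(1) G(1) by (auto intro: polynomial_functions.mult)
  moreover have "S \<inter> T = V - zero_locus V ?H"
    unfolding F(2) G(2) zero_locus_def by fastforce
  ultimately show "\<exists>F \<subseteq> polynomial_functions V. S \<inter> T = V - zero_locus V F" by blast
next
  fix K
  assume "\<forall>S\<in>K. \<exists>F \<subseteq> polynomial_functions V. S = V - zero_locus V F"
  then obtain F where F: "\<And>S. S \<in> K \<Longrightarrow> F S \<subseteq> polynomial_functions V"
    "\<And>S. S \<in> K \<Longrightarrow> S = V - zero_locus V (F S)" by metis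
  have "\<Union>K = (\<Union>S\<in>K. V - zero_locus V (F S))" using F(2) by auto
  also have "\<dots> = V - zero_locus V (\<Union>(F ` K))"
    unfolding zero_locus_def by blast
  finally show "\<exists>F \<subseteq> polynomial_functions V. \<Union>K = V - zero_locus V F"
    using F(1) by (intro exI[of _ "\<Union>(F ` K)"]) auto
qed

lemma openin_zariski:
  "openin (zariski V) U \<longleftrightarrow> (\<exists>F \<subseteq> polynomial_functions V. U = V - zero_locus V F)"
  unfolding zariski_def using istopology_zariski[of V] by (simp add: topology_inverse')

definition irreducible_in :: "'b topology \<Rightarrow> 'b set \<Rightarrow> bool" where
  "irreducible_in X S \<longleftrightarrow> S \<subseteq> topspace X \<and> S \<noteq> {} \<and>
     (\<forall>A B. closedin X A \<and> closedin X B \<and> S \<subseteq> A \<union> B \<longrightarrow> S \<subseteq> A \<or> S \<subseteq> B)"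

(* Krull dimension; the empty space gets 0 here instead of the usual minus infinity. *)
definition krull_dim :: "'b topology \<Rightarrow> enat" where
  "krull_dim X = Sup {enat m | m. \<exists>Z :: nat \<Rightarrow> 'b set.
     (\<forall>i\<le>m. closedin X (Z i) \<and> irreducible_in X (Z i)) \<and> (\<forall>i<m. Z i \<subset> Z (Suc i))}"

definition orbit_dim ::
    "'a::field_char_0 fls set \<Rightarrow> 'a \<Rightarrow> nat \<Rightarrow> ('a fls \<Rightarrow> 'a) \<Rightarrow> enat" where
  "orbit_dim \<gg> x n \<nu> = krull_dim (subtopology (zariski (Loc \<gg> x n)) (orbit \<gg> x n \<nu>))"

end

theory Submission
  imports Defs "HOL-Library.Function_Algebras"
begin

text \<open>
  A functional \<open>f \<mapsto> \<Sum>i\<le>n. c i * f\<^sub>i\<close> on power series vector fields \<open>f \<partial>\<close>, in the local coordinate \<open>u = t - x\<close>,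
  is the pairing \<open>f \<mapsto> Res (f q du)\<close> with \<open>q = \<Sum>i\<le>n. c i u\<^bsup>-i-1\<^esup>\<close>. The product of a vector field and a
  quadratic differential is a differential, so coordinate changes act on \<open>c\<close> as they act on the polar
  part of the quadratic differential \<open>q du\<^sup>2\<close>, whose pole has order \<open>n + 1\<close> when \<open>c n \<noteq> 0\<close>. The theorem
  is the local classification of such polar parts.
  
  Normal forms. The change \<open>u \<mapsto> u + \<mu> u\<^bsup>l+1\<^esup>\<close> leaves the coefficients above \<open>n - l\<close> alone and adds
  \<open>(n - 2 l - 1) \<mu> c n\<close> to \<open>c (n - l)\<close>. So every lower coefficient can be killed, from the top down,
  except the resonant one with \<open>n = 2 l + 1\<close>, which has index \<open>(n + 1) / 2\<close>; a scaling then makes the top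
  coefficient \<open>1\<close> if \<open>n \<noteq> 1\<close> (\<open>equiv_normal_form\<close>). The same formula shows that a
  change of coordinates between two normal forms has trivial terms up to the resonance, where only its
  linear part \<open>r\<close> with \<open>r\<^bsup>2k\<^esup> = 1\<close> acts, by \<open>r\<^bsup>k\<^esup> = \<plusminus>1\<close> (\<open>normal_form_equiv_iff\<close>). For \<open>n = 1\<close> the resonant
  coefficient is the top one, which is therefore invariant.
  
  Equations of the orbits. For even \<open>n\<close> there is one normal form, so the orbit is the set \<open>c n \<noteq> 0\<close>, of
  dimension \<open>n + 1\<close>. For \<open>n = 2 k + 1\<close> the polar part has a square root, a differential with a pole of
  order \<open>k + 1\<close>, and the residue of this differential is invariant up to sign. It takes the value \<open>b / 2\<close> on
  the normal form with parameter \<open>b\<close>, so the orbits are exactly the sets with given residue up to sign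
  (\<open>equiv_normal_form_iff_residue\<close>). The coefficients of the square root other than its residue and the
  \<open>k + 1\<close> lowest coefficients of \<open>q\<close> are \<open>n\<close> free parameters for the orbit.
  
  Dimension. Each orbit is thus the image of an open set of an affine space under a polynomial map.
  The elements of a chain of irreducible closed sets of length \<open>m\<close> give \<open>m\<close> algebraically independent
  functions of the parameters, so there are at least \<open>m\<close> parameters; and letting the parameters vanish one
  after another gives a chain of the maximal length (\<open>krull_dim_parametrized\<close>).
\<close>

section \<open>Coordinate changes of formal vector fields\<close>

definition uniformizer :: "'a::field fps \<Rightarrow> bool" where
  "uniformizer \<sigma> \<longleftrightarrow> fps_nth \<sigma> 0 = 0 \<and> fps_nth \<sigma> 1 \<noteq> 0"

text \<open>
  Pullback of the vector field \<open>f d/du\<close> along the coordinate change \<open>u \<mapsto> \<sigma>\<close>.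
\<close>

definition vf_subst :: "'a::field fps \<Rightarrow> 'a fps \<Rightarrow> 'a fps" where
  "vf_subst \<sigma> f = fps_compose f \<sigma> * inverse (fps_deriv \<sigma>)"

definition coeff_form :: "nat \<Rightarrow> (nat \<Rightarrow> 'a::field) \<Rightarrow> 'a fps \<Rightarrow> 'a" where
  "coeff_form n c f = (\<Sum>i\<le>n. c i * fps_nth f i)"

lemma fps_compose_mult_nth:
  fixes f \<sigma> d :: "'a::field fps"
  assumes "fps_nth \<sigma> 0 = 0"
  shows "fps_nth (fps_compose f \<sigma> * d) j = (\<Sum>i\<le>j. fps_nth f i * fps_nth (\<sigma> ^ i * d) j)"
proof -
  have "fps_nth (fps_compose f \<sigma> * d) j
      = (\<Sum>k\<le>j. (\<Sum>i\<le>k. fps_nth f i * fps_nth (\<sigma> ^ i) k) * fps_nth d (j - k))"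
    by (simp add: fps_mult_nth fps_compose_nth atLeast0AtMost)
  also have "\<dots> = (\<Sum>k\<le>j. (\<Sum>i\<le>j. fps_nth f i * fps_nth (\<sigma> ^ i) k) * fps_nth d (j - k))"
  proof (rule sum.cong[OF refl])
    fix k assume "k \<in> {..j}"
    then have "(\<Sum>i\<le>k. fps_nth f i * fps_nth (\<sigma> ^ i) k) = (\<Sum>i\<le>j. fps_nth f i * fps_nth (\<sigma> ^ i) k)"
      using assms by (intro sum.mono_neutral_left) (auto simp: startsby_zero_power_prefix)
    then show "(\<Sum>i\<le>k. fps_nth f i * fps_nth (\<sigma> ^ i) k) * fps_nth d (j - k)
        = (\<Sum>i\<le>j. fps_nth f i * fps_nth (\<sigma> ^ i) k) * fps_nth d (j - k)" by simp
  qed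
  also have "\<dots> = (\<Sum>i\<le>j. \<Sum>k\<le>j. fps_nth f i * fps_nth (\<sigma> ^ i) k * fps_nth d (j - k))"
    by (subst sum.swap) (simp add: sum_distrib_right)
  also have "\<dots> = (\<Sum>i\<le>j. fps_nth f i * fps_nth (\<sigma> ^ i * d) j)"
    by (simp add: fps_mult_nth sum_distrib_left mult.assoc atLeast0AtMost)
  finally show ?thesis .
qed

lemma uniformizer_factor: "uniformizer \<sigma> \<Longrightarrow> \<sigma> = fps_X * fps_shift 1 \<sigma>"
  unfolding uniformizer_def by (intro fps_ext) auto

lemma uniformizer_deriv: "uniformizer \<sigma> \<Longrightarrow> fps_nth (fps_deriv \<sigma>) 0 \<noteq> 0"
  unfolding uniformizer_def by simp

lemma uniformizer_X: "uniformizer fps_X"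
  unfolding uniformizer_def by simp

lemma uniformizer_compose:
  assumes "uniformizer \<tau>" "uniformizer \<sigma>" shows "uniformizer (fps_compose \<tau> \<sigma>)"
  using assms unfolding uniformizer_def by (simp add: fps_compose_nth)

lemma uniformizer_inv:
  assumes "uniformizer \<sigma>" shows "uniformizer (fps_inv \<sigma>)"
proof -
  have "fps_nth (fps_inv \<sigma>) 0 = 0" by (simp add: fps_inv_def)
  moreover have "fps_nth (fps_inv \<sigma>) 1 \<noteq> 0"
    using assms by (simp add: fps_inv_def uniformizer_def)
  ultimately show ?thesis by (simp add: uniformizer_def)
qed

lemma vf_subst_X [simp]: "vf_subst fps_X f = f"
  by (simp add: vf_subst_def)

lemma vf_subst_compose:
  assumes "uniformizer \<sigma>" "uniformizer \<tau>"
  shows "vf_subst \<sigma> (vf_subst \<tau> f) = vf_subst (fps_compose \<tau> \<sigma>) f"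
proof -
  have s: "fps_nth \<sigma> 0 = 0" and t: "fps_nth \<tau> 0 = 0" using assms by (auto simp: uniformizer_def)
  have "vf_subst \<sigma> (vf_subst \<tau> f)
      = fps_compose (fps_compose f \<tau>) \<sigma> * (fps_compose (inverse (fps_deriv \<tau>)) \<sigma> * inverse (fps_deriv \<sigma>))"
    by (simp add: vf_subst_def fps_compose_mult_distrib[OF s] mult.assoc)
  also have "fps_compose (inverse (fps_deriv \<tau>)) \<sigma> = inverse (fps_compose (fps_deriv \<tau>) \<sigma>)"
    using s uniformizer_deriv[OF assms(2)] by (rule fps_inverse_compose)
  also have "fps_compose (fps_compose f \<tau>) \<sigma> = fps_compose f (fps_compose \<tau> \<sigma>)"
    using s t by (simp add: fps_compose_assoc)
  finally show ?thesis
    by (simp add: vf_subst_def fps_compose_deriv[OF s] fps_inverse_mult)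
qed

lemma vf_subst_inv:
  assumes "uniformizer \<sigma>"
  shows "vf_subst \<sigma> (vf_subst (fps_inv \<sigma>) f) = f" "vf_subst (fps_inv \<sigma>) (vf_subst \<sigma> f) = f"
  using assms vf_subst_compose[OF assms uniformizer_inv[OF assms]]
    vf_subst_compose[OF uniformizer_inv[OF assms] assms]
  by (auto simp: uniformizer_def fps_inv fps_inv_right)

text \<open>
  Pulling back does not lower the order of vanishing, so the pulled back functional still depends on
  the first \<open>n + 1\<close> coefficients only. This is why the group acts on functionals of bounded order.
\<close>

lemma coeff_form_vf_subst:
  assumes "uniformizer \<sigma>"
  shows "coeff_form n c (vf_subst \<sigma> f)
    = coeff_form n (\<lambda>i. coeff_form n c (vf_subst \<sigma> (fps_X ^ i))) f"
proof -
  have s: "fps_nth \<sigma> 0 = 0" using assms by (auto simp: uniformizer_def)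
  have nth: "fps_nth (vf_subst \<sigma> f) j = (\<Sum>i\<le>n. fps_nth f i * fps_nth (vf_subst \<sigma> (fps_X ^ i)) j)"
    if "j \<le> n" for j
  proof -
    have z: "fps_nth (\<sigma> ^ i * d) j = 0" if "j < i" for i d
      using that s by (simp add: fps_mult_nth startsby_zero_power_prefix)
    have "fps_nth (vf_subst \<sigma> f) j = (\<Sum>i\<le>j. fps_nth f i * fps_nth (vf_subst \<sigma> (fps_X ^ i)) j)"
      by (simp add: vf_subst_def fps_compose_mult_nth[OF s] fps_X_power_compose[OF s])
    also have "\<dots> = (\<Sum>i\<le>n. fps_nth f i * fps_nth (vf_subst \<sigma> (fps_X ^ i)) j)"
      using that z by (intro sum.mono_neutral_left) (auto simp: vf_subst_def fps_X_power_compose[OF s])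
    finally show ?thesis .
  qed
  have "coeff_form n c (vf_subst \<sigma> f)
      = (\<Sum>j\<le>n. \<Sum>i\<le>n. c j * (fps_nth f i * fps_nth (vf_subst \<sigma> (fps_X ^ i)) j))"
    by (simp add: coeff_form_def nth sum_distrib_left)
  also have "\<dots> = (\<Sum>i\<le>n. \<Sum>j\<le>n. c j * (fps_nth f i * fps_nth (vf_subst \<sigma> (fps_X ^ i)) j))"
    by (rule sum.swap)
  finally show ?thesis
    by (simp add: coeff_form_def sum_distrib_left mult.left_commute mult.commute)
qed

section \<open>Leading terms of a coordinate change\<close>

text \<open>
  The series \<open>f\<^sub>0 + f\<^sub>l u\<^sup>l + \<dots>\<close>. Up to order \<open>l\<close> they multiply like dual numbers, so their powers and
  inverses have gaps again and explicit coefficients at \<open>u\<^sup>l\<close>.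
\<close>

definition gap :: "nat \<Rightarrow> 'a::field fps \<Rightarrow> bool" where
  "gap l f \<longleftrightarrow> (\<forall>j. 0 < j \<and> j < l \<longrightarrow> fps_nth f j = 0)"

lemma gap_mult_nth:
  assumes "gap l p" "gap l q" "0 < j" "j \<le> l"
  shows "fps_nth (p * q) j = fps_nth p 0 * fps_nth q j + fps_nth p j * fps_nth q 0"
proof -
  have "fps_nth (p * q) j = (\<Sum>i\<in>{0..j}. fps_nth p i * fps_nth q (j - i))"
    by (simp add: fps_mult_nth)
  also have "\<dots> = (\<Sum>i\<in>{0,j}. fps_nth p i * fps_nth q (j - i))"
    using assms by (intro sum.mono_neutral_right) (auto simp: gap_def)
  finally show ?thesis using assms by simp
qed

lemma gap_mult: "gap l p \<Longrightarrow> gap l q \<Longrightarrow> gap l (p * q)"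
  using gap_mult_nth[of l p q] unfolding gap_def by auto

lemma gap_power: "gap l p \<Longrightarrow> gap l (p ^ i)"
  by (induction i) (auto simp: gap_mult, simp add: gap_def)

lemma gap_power_nth:
  assumes "gap l p" "0 < l" "fps_nth p 0 \<noteq> 0"
  shows "fps_nth (p ^ i) l = of_nat i * fps_nth p 0 ^ i / fps_nth p 0 * fps_nth p l"
proof (induction i)
  case 0 then show ?case using assms by simp
next
  case (Suc i)
  have "fps_nth (p ^ Suc i) l = fps_nth p 0 * fps_nth (p ^ i) l + fps_nth p l * fps_nth p 0 ^ i"
    using gap_mult_nth[OF assms(1) gap_power[OF assms(1)] assms(2) order_refl]
    by (simp add: fps_nth_power_0)
  then show ?case using Suc assms(3) by (simp add: field_simps)
qed

lemma gap_inverse: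
  assumes "gap l p" "fps_nth p 0 \<noteq> 0"
  shows "gap l (inverse p)"
    and "0 < l \<Longrightarrow> fps_nth (inverse p) l = - fps_nth p l / fps_nth p 0 ^ 2"
proof -
  have one: "p * inverse p = 1" using assms(2) by (simp add: inverse_mult_eq_1')
  have "fps_nth (inverse p) j = 0" if "0 < j" "j < l" for j
    using that
  proof (induction j rule: less_induct)
    case (less j)
    have "gap j p" "gap j (inverse p)" using less assms(1) by (auto simp: gap_def)
    from gap_mult_nth[OF this less.prems(1) order_refl]
    show ?case using less assms by (simp add: one gap_def)
  qed
  then show g: "gap l (inverse p)" by (simp add: gap_def)
  assume "0 < l"
  from gap_mult_nth[OF assms(1) g this order_refl] \<open>0 < l\<close>
  have "fps_nth p 0 * fps_nth (inverse p) l + fps_nth p l * inverse (fps_nth p 0) = 0"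
    by (simp add: one)
  then have "fps_nth p 0 * fps_nth (inverse p) l = - fps_nth p l * inverse (fps_nth p 0)"
    by (simp add: eq_neg_iff_add_eq_0)
  then show "fps_nth (inverse p) l = - fps_nth p l / fps_nth p 0 ^ 2"
    using assms(2) by (simp add: field_simps power2_eq_square)
qed

lemma vf_subst_X_power:
  assumes "uniformizer \<sigma>"
  shows "vf_subst \<sigma> (fps_X ^ i) = fps_X ^ i * (fps_shift 1 \<sigma> ^ i * inverse (fps_deriv \<sigma>))"
proof -
  have "\<sigma> ^ i = fps_X ^ i * fps_shift 1 \<sigma> ^ i"
    by (subst uniformizer_factor[OF assms]) (simp add: power_mult_distrib)
  then show ?thesis
    using assms by (simp add: vf_subst_def fps_X_power_compose uniformizer_def mult.assoc)
qed

lemma vf_subst_nth_lower: "uniformizer \<sigma> \<Longrightarrow> j < i \<Longrightarrow> fps_nth (vf_subst \<sigma> (fps_X ^ i)) j = 0"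
  by (simp add: vf_subst_X_power fps_X_power_mult_nth)

lemma vf_subst_nth_diag:
  "uniformizer \<sigma> \<Longrightarrow> fps_nth (vf_subst \<sigma> (fps_X ^ i)) i = fps_nth \<sigma> 1 ^ i / fps_nth \<sigma> 1"
  by (simp add: vf_subst_X_power fps_X_power_mult_nth fps_nth_power_0 divide_inverse)

text \<open>
  The computation behind the classification: the first nonlinear term of \<open>\<sigma>\<close>, of degree \<open>l + 1\<close>, enters
  \<open>\<sigma>\<^sup>i\<close> with weight \<open>i\<close> and \<open>1 / \<sigma>'\<close> with weight \<open>- (l + 1)\<close>.
\<close>

lemma vf_subst_nth_gap:
  assumes "uniformizer \<sigma>" "0 < l" "\<And>j. 2 \<le> j \<Longrightarrow> j \<le> l \<Longrightarrow> fps_nth \<sigma> j = 0"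
  shows "i < j \<Longrightarrow> j < i + l \<Longrightarrow> fps_nth (vf_subst \<sigma> (fps_X ^ i)) j = 0"
    and "fps_nth (vf_subst \<sigma> (fps_X ^ i)) (i + l)
      = (of_nat i - of_nat l - 1) * fps_nth \<sigma> (l + 1) * fps_nth \<sigma> 1 ^ i / fps_nth \<sigma> 1 ^ 2"
proof -
  let ?w = "fps_shift 1 \<sigma>" and ?d = "inverse (fps_deriv \<sigma>)"
  have s1: "fps_nth \<sigma> 1 \<noteq> 0" using assms(1) by (simp add: uniformizer_def)
  have gw: "gap l ?w" and gd0: "gap l (fps_deriv \<sigma>)" using assms(3) by (auto simp: gap_def)
  have gd: "gap l ?d" using gap_inverse(1)[OF gd0] s1 by simp
  note gi = gap_power[OF gw, of i]
  show "fps_nth (vf_subst \<sigma> (fps_X ^ i)) j = 0" if "i < j" "j < i + l"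
    using gap_mult[OF gi gd] that
    by (simp add: vf_subst_X_power[OF assms(1)] fps_X_power_mult_nth gap_def)
  have "fps_nth (vf_subst \<sigma> (fps_X ^ i)) (i + l) = fps_nth (?w ^ i * ?d) l"
    by (simp add: vf_subst_X_power[OF assms(1)] fps_X_power_mult_nth)
  also have "\<dots> = fps_nth (?w ^ i) 0 * fps_nth ?d l + fps_nth (?w ^ i) l * fps_nth ?d 0"
    by (rule gap_mult_nth[OF gi gd assms(2) order_refl])
  also have "\<dots> = (of_nat i - of_nat l - 1) * fps_nth \<sigma> (l + 1) * fps_nth \<sigma> 1 ^ i / fps_nth \<sigma> 1 ^ 2"
  proof -
    have "fps_nth (?w ^ i) l = of_nat i * fps_nth \<sigma> 1 ^ i / fps_nth \<sigma> 1 * fps_nth \<sigma> (l + 1)"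
      using s1 gap_power_nth[OF gw assms(2), of i] by simp
    moreover have "fps_nth ?d l = - (of_nat l + 1) * fps_nth \<sigma> (l + 1) / fps_nth \<sigma> 1 ^ 2"
      using s1 gap_inverse(2)[OF gd0 _ assms(2)] by (simp add: algebra_simps)
    moreover have "fps_nth (?w ^ i) 0 = fps_nth \<sigma> 1 ^ i" "fps_nth ?d 0 = inverse (fps_nth \<sigma> 1)"
      by (simp_all add: fps_nth_power_0)
    ultimately show ?thesis
      using s1 by (simp only:) (simp add: field_simps power2_eq_square)
  qed
  finally show "fps_nth (vf_subst \<sigma> (fps_X ^ i)) (i + l)
      = (of_nat i - of_nat l - 1) * fps_nth \<sigma> (l + 1) * fps_nth \<sigma> 1 ^ i / fps_nth \<sigma> 1 ^ 2" .
qed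

section \<open>Normal forms\<close>

text \<open>
  Orbit equivalence of functionals of order at most \<open>n\<close>, in terms of their coefficients.
\<close>

definition equiv_form :: "nat \<Rightarrow> (nat \<Rightarrow> 'a::field) \<Rightarrow> (nat \<Rightarrow> 'a) \<Rightarrow> bool" where
  "equiv_form n c d \<longleftrightarrow>
     (\<exists>\<sigma>. uniformizer \<sigma> \<and> (\<forall>f. coeff_form n c (vf_subst \<sigma> f) = coeff_form n d f))"

lemma equiv_formI:
  "uniformizer \<sigma> \<Longrightarrow> equiv_form n c (\<lambda>i. coeff_form n c (vf_subst \<sigma> (fps_X ^ i)))"
  unfolding equiv_form_def using coeff_form_vf_subst by blast

lemma equiv_form_refl: "equiv_form n c c"
  unfolding equiv_form_def using uniformizer_X vf_subst_X by metis

lemma equiv_form_sym: "equiv_form n c d \<Longrightarrow> equiv_form n d c"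
  unfolding equiv_form_def using uniformizer_inv vf_subst_inv(1) by metis

lemma equiv_form_trans: "equiv_form n c d \<Longrightarrow> equiv_form n d e \<Longrightarrow> equiv_form n c e"
  unfolding equiv_form_def using uniformizer_compose vf_subst_compose by metis

lemma coeff_form_X_power: "coeff_form n c (fps_X ^ i) = (if i \<le> n then c i else 0)"
proof -
  have "coeff_form n c (fps_X ^ i) = (\<Sum>j\<le>n. if i = j then c j else 0)"
    unfolding coeff_form_def by (intro sum.cong) auto
  then show ?thesis by simp
qed

lemma coeff_form_eq_iff: "coeff_form n c = coeff_form n d \<longleftrightarrow> (\<forall>i\<le>n. c i = d i)"
proof
  assume "coeff_form n c = coeff_form n d"
  then have "coeff_form n c (fps_X ^ i) = coeff_form n d (fps_X ^ i)" for i by simp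
  then show "\<forall>i\<le>n. c i = d i" by (metis coeff_form_X_power)
qed (auto simp: coeff_form_def)

lemma coeff_form_subst_top:
  assumes "uniformizer \<sigma>"
  shows "coeff_form n c (vf_subst \<sigma> (fps_X ^ n)) = c n * (fps_nth \<sigma> 1 ^ n / fps_nth \<sigma> 1)"
proof -
  have "coeff_form n c (vf_subst \<sigma> (fps_X ^ n)) = (\<Sum>j\<in>{n}. c j * fps_nth (vf_subst \<sigma> (fps_X ^ n)) j)"
    unfolding coeff_form_def using assms by (intro sum.mono_neutral_right) (auto simp: vf_subst_nth_lower)
  then show ?thesis using assms by (simp add: vf_subst_nth_diag)
qed

lemma equiv_form_top_nonzero:
  assumes "equiv_form n c d" "c n \<noteq> 0" shows "d n \<noteq> 0"
proof -
  obtain \<sigma> where "uniformizer \<sigma>" "\<forall>f. coeff_form n c (vf_subst \<sigma> f) = coeff_form n d f"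
    using assms(1) by (auto simp: equiv_form_def)
  then have "d n = c n * (fps_nth \<sigma> 1 ^ n / fps_nth \<sigma> 1)"
    by (metis coeff_form_X_power coeff_form_subst_top order_refl)
  then show ?thesis using assms(2) \<open>uniformizer \<sigma>\<close> by (simp add: uniformizer_def)
qed

text \<open>
  At \<open>n = 2 l + 1\<close> the factor in front of the new coefficient vanishes: this is the resonance.
\<close>

lemma coeff_form_subst_gap:
  assumes "uniformizer \<sigma>" "0 < l" "\<And>j. 2 \<le> j \<Longrightarrow> j \<le> l \<Longrightarrow> fps_nth \<sigma> j = 0" "l \<le> n"
  shows "n - l < i \<Longrightarrow> i \<le> n \<Longrightarrow> 
      coeff_form n c (vf_subst \<sigma> (fps_X ^ i)) = c i * (fps_nth \<sigma> 1 ^ i / fps_nth \<sigma> 1)"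
    and "coeff_form n c (vf_subst \<sigma> (fps_X ^ (n - l))) = c (n - l) * (fps_nth \<sigma> 1 ^ (n - l) / fps_nth \<sigma> 1)
      + c n * ((of_nat n - 2 * of_nat l - 1) * fps_nth \<sigma> (l + 1) * fps_nth \<sigma> 1 ^ (n - l) / fps_nth \<sigma> 1 ^ 2)"
proof -
  show "coeff_form n c (vf_subst \<sigma> (fps_X ^ i)) = c i * (fps_nth \<sigma> 1 ^ i / fps_nth \<sigma> 1)"
    if "n - l < i" "i \<le> n"
  proof -
    have "coeff_form n c (vf_subst \<sigma> (fps_X ^ i)) = (\<Sum>j\<in>{i}. c j * fps_nth (vf_subst \<sigma> (fps_X ^ i)) j)"
      unfolding coeff_form_def
    proof (intro sum.mono_neutral_right ballI)
      fix j assume "j \<in> {..n} - {i}"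
      then have "j < i \<or> i < j \<and> j < i + l" using that by auto
      then show "c j * fps_nth (vf_subst \<sigma> (fps_X ^ i)) j = 0"
        using vf_subst_nth_lower[OF assms(1)] vf_subst_nth_gap(1)[OF assms(1-3)] by auto
    qed (use that in auto)
    then show ?thesis by (simp add: vf_subst_nth_diag[OF assms(1)])
  qed
  let ?i = "n - l"
  have "coeff_form n c (vf_subst \<sigma> (fps_X ^ ?i)) = (\<Sum>j\<in>{?i, n}. c j * fps_nth (vf_subst \<sigma> (fps_X ^ ?i)) j)"
    unfolding coeff_form_def
  proof (intro sum.mono_neutral_right ballI)
    fix j assume "j \<in> {..n} - {?i, n}"
    then have "j < ?i \<or> ?i < j \<and> j < ?i + l" using assms(4) by auto
    then show "c j * fps_nth (vf_subst \<sigma> (fps_X ^ ?i)) j = 0"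
      using vf_subst_nth_lower[OF assms(1)] vf_subst_nth_gap(1)[OF assms(1-3)] by auto
  qed (use assms in auto)
  also have "\<dots> = c ?i * fps_nth (vf_subst \<sigma> (fps_X ^ ?i)) ?i + c n * fps_nth (vf_subst \<sigma> (fps_X ^ ?i)) (?i + l)"
    using assms(2,4) by simp
  finally show "coeff_form n c (vf_subst \<sigma> (fps_X ^ (n - l))) = c (n - l) * (fps_nth \<sigma> 1 ^ (n - l) / fps_nth \<sigma> 1)
      + c n * ((of_nat n - 2 * of_nat l - 1) * fps_nth \<sigma> (l + 1) * fps_nth \<sigma> 1 ^ (n - l) / fps_nth \<sigma> 1 ^ 2)"
    using vf_subst_nth_gap(2)[OF assms(1-3), of "n - l"]
    by (simp add: vf_subst_nth_diag[OF assms(1)] of_nat_diff[OF assms(4)] algebra_simps)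
qed

lemma equiv_form_scale:
  fixes c :: "nat \<Rightarrow> 'a::field"
  assumes "r \<noteq> 0" shows "equiv_form n c (\<lambda>i. r ^ i / r * c i)"
proof -
  let ?\<sigma> = "fps_const r * fps_X"
  have u: "uniformizer ?\<sigma>" using assms by (simp add: uniformizer_def)
  have "coeff_form n c (vf_subst ?\<sigma> f) = coeff_form n (\<lambda>i. r ^ i / r * c i) f" for f
  proof -
    have "vf_subst ?\<sigma> f = Abs_fps (\<lambda>i. r ^ i * fps_nth f i) * fps_const (inverse r)"
      by (simp add: vf_subst_def fps_compose_linear fps_const_inverse)
    then show ?thesis by (simp add: coeff_form_def divide_inverse mult_ac)
  qed
  then show ?thesis using u unfolding equiv_form_def by blast
qed

lemma eliminate_coefficient:
  fixes c :: "nat \<Rightarrow> 'a::field_char_0"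
  assumes "c n \<noteq> 0" "0 < l" "l \<le> n" "n \<noteq> 2 * l + 1"
  shows "\<exists>d. equiv_form n c d \<and> (\<forall>i. n - l < i \<and> i \<le> n \<longrightarrow> d i = c i) \<and> d (n - l) = 0"
proof -
  have ne: "(of_nat n - 2 * of_nat l - 1 :: 'a) \<noteq> 0"
  proof
    assume "(of_nat n - 2 * of_nat l - 1 :: 'a) = 0"
    then have "(of_nat n :: 'a) = of_nat (2 * l + 1)" by (simp add: algebra_simps)
    then show False using assms(4) of_nat_eq_iff by blast
  qed
  define \<mu> where "\<mu> = - c (n - l) / (c n * (of_nat n - 2 * of_nat l - 1))"
  define \<sigma> where "\<sigma> = fps_X + fps_const \<mu> * fps_X ^ (l + 1)"
  have s: "fps_nth \<sigma> 1 = 1" "fps_nth \<sigma> (l + 1) = \<mu>"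
    "\<And>j. 2 \<le> j \<Longrightarrow> j \<le> l \<Longrightarrow> fps_nth \<sigma> j = 0"
    using assms(2) by (auto simp: \<sigma>_def)
  have u: "uniformizer \<sigma>" using s by (simp add: uniformizer_def \<sigma>_def)
  show ?thesis
    using equiv_formI[OF u, of n c] coeff_form_subst_gap[OF u assms(2) s(3) assms(3), where c = c]
      ne assms(1) s(1,2)
    by (intro exI[of _ "\<lambda>i. coeff_form n c (vf_subst \<sigma> (fps_X ^ i))"]) (simp add: \<mu>_def)
qed

text \<open>
  Eliminating a coefficient disturbs only the lower ones, so the coefficients are treated from the top
  down. The resonant index \<open>i\<close>, for which \<open>n + 1 = 2 * i\<close>, is skipped.
\<close>

lemma eliminate_lower_coefficients:
  fixes c :: "nat \<Rightarrow> 'a::field_char_0"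
  assumes "c n \<noteq> 0"
  shows "\<exists>d. equiv_form n c d \<and> d n = c n \<and> (\<forall>i<n. n + 1 \<noteq> 2 * i \<longrightarrow> d i = 0)"
proof -
  have "l \<le> n \<Longrightarrow> \<exists>d. equiv_form n c d \<and> d n = c n \<and>
      (\<forall>i<n. n - l \<le> i \<and> n + 1 \<noteq> 2 * i \<longrightarrow> d i = 0)" for l
  proof (induction l)
    case 0
    then show ?case using equiv_form_refl by auto
  next
    case (Suc l)
    then obtain d where d: "equiv_form n c d" "d n = c n"
      "\<forall>i<n. n - l \<le> i \<and> n + 1 \<noteq> 2 * i \<longrightarrow> d i = 0" by auto
    show ?case
    proof (cases "n = 2 * Suc l + 1")
      case True
      have "d i = 0" if "i < n" "n - Suc l \<le> i" "n + 1 \<noteq> 2 * i" for i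
      proof -
        have "n - l \<le> i" using True that by presburger
        then show ?thesis using d(3) that by auto
      qed
      then show ?thesis using d by blast
    next
      case False
      have "d n \<noteq> 0" using d(2) assms by simp
      from eliminate_coefficient[of d n "Suc l", OF this zero_less_Suc Suc.prems False]
      obtain e where e: "equiv_form n d e" "\<forall>i. n - Suc l < i \<and> i \<le> n \<longrightarrow> e i = d i" "e (n - Suc l) = 0"
        by blast
      have "e i = 0" if i: "i < n" "n - Suc l \<le> i" "n + 1 \<noteq> 2 * i" for i
      proof (cases "i = n - Suc l")
        case False
        then have "n - Suc l < i" "n - l \<le> i" using i by linarith+
        then show ?thesis using e(2) d(3) i by simp
      qed (use e in simp)
      moreover have "e n = c n" using e(2) d(2) Suc.prems by auto
      ultimately show ?thesis using equiv_form_trans[OF d(1) e(1)] by blast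
    qed
  qed
  from this[OF order_refl] show ?thesis by auto
qed

lemma equiv_form_cong: "equiv_form n c d \<Longrightarrow> (\<And>i. i \<le> n \<Longrightarrow> d i = e i) \<Longrightarrow> equiv_form n c e"
  using coeff_form_eq_iff[of n d e] by (auto simp: equiv_form_def)

text \<open>
  The entry \<open>b\<close> sits at the resonant index; for even \<open>n\<close> there is none, and \<open>b\<close> drops out.
\<close>

definition normal_form :: "nat \<Rightarrow> 'a::field \<Rightarrow> nat \<Rightarrow> 'a" where
  "normal_form n b = (\<lambda>i. if i = n then 1 else if 2 * i = n + 1 then b else 0)"

lemma equiv_normal_form:
  fixes c :: "nat \<Rightarrow> 'a::{alg_closed_field,field_char_0}"
  assumes "c n \<noteq> 0" "n \<noteq> 1"
  shows "\<exists>b. equiv_form n c (normal_form n b)"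
proof -
  obtain d where d: "equiv_form n c d" "d n = c n" "\<forall>i<n. n + 1 \<noteq> 2 * i \<longrightarrow> d i = 0"
    using eliminate_lower_coefficients[where c = c and n = n] assms(1) by auto
  obtain r where r: "r \<noteq> 0" "r ^ n / r * c n = 1"
  proof (cases "n = 0")
    case True
    then show ?thesis using that[of "c n"] assms by auto
  next
    case False
    then have n: "n = Suc (n - 1)" "0 < n - 1" using assms(2) by auto
    obtain y where y: "y ^ (n - 1) = inverse (c n)" using nth_root_exists[OF n(2)] by blast
    then have y0: "y \<noteq> 0" using assms(1) n(2) by (metis inverse_nonzero_iff_nonzero power_0_left not_gr_zero)
    have "y ^ n / y = y ^ (n - 1)" by (subst n(1)) (simp add: y0)
    then show ?thesis using that[OF y0] y assms(1) by simp
  qed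
  define b where "b = r ^ ((n + 1) div 2) / r * d ((n + 1) div 2)"
  have "equiv_form n c (\<lambda>i. r ^ i / r * d i)"
    using equiv_form_trans[OF d(1) equiv_form_scale[OF r(1)]] .
  then have "equiv_form n c (normal_form n b)"
  proof (rule equiv_form_cong)
    fix i assume "i \<le> n"
    moreover have "i = (n + 1) div 2" if "2 * i = n + 1" using that by linarith
    ultimately show "r ^ i / r * d i = normal_form n b i"
      using r d(2,3) by (auto simp: normal_form_def b_def)
  qed
  then show ?thesis by blast
qed

lemma equiv_normal_form_even:
  fixes c :: "nat \<Rightarrow> 'a::{alg_closed_field,field_char_0}"
  assumes "c n \<noteq> 0" "even n"
  shows "equiv_form n c (normal_form n 0)"
proof -
  have "2 * i \<noteq> n + 1" for i using assms(2) by presburger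
  then have *: "normal_form n b = (normal_form n 0 :: nat \<Rightarrow> 'a)" for b
    by (simp add: normal_form_def fun_eq_iff)
  have "n \<noteq> 1" using assms(2) by auto
  from equiv_normal_form[of c n, OF assms(1) this]
  obtain b where "equiv_form n c (normal_form n b)" by blast
  then show ?thesis by (simp only: *[of b])
qed

text \<open>
  Scaling by \<open>y\<close> with \<open>y\<^sup>k = -1\<close> fixes the top coefficient, since \<open>y\<^bsup>2k\<^esup> = 1\<close>, and negates the resonant one.
\<close>

lemma normal_form_uminus:
  assumes "k \<ge> 1"
  shows "equiv_form (2 * k + 1) (normal_form (2 * k + 1) b) (normal_form (2 * k + 1) (- b :: 'a::{alg_closed_field,field_char_0}))"
proof -
  obtain y :: 'a where y: "y ^ k = -1" using nth_root_exists[of k "-1"] assms by auto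
  then have y0: "y \<noteq> 0" using assms by (metis power_0_left neg_equal_0_iff_equal not_one_le_zero zero_neq_one)
  have y2: "y ^ (2 * k) = 1" using y by (simp add: mult.commute[of 2] power_mult)
  show ?thesis
  proof (rule equiv_form_cong[OF equiv_form_scale[OF y0]])
    fix i :: nat assume "i \<le> 2 * k + 1"
    have "2 * i = 2 * k + 1 + 1 \<longleftrightarrow> i = k + 1" by auto
    then show "y ^ i / y * normal_form (2 * k + 1) b i = normal_form (2 * k + 1) (- b) i"
      using y y0 y2 by (auto simp: normal_form_def)
  qed
qed

text \<open>
  A first nonlinear term of degree \<open>l + 1\<close> with \<open>l < k\<close> would create a nonzero coefficient at \<open>n - l\<close>,
  which neither normal form has. So the coordinate change is linear up to the resonance, where its
  next term has no effect.
\<close>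

lemma normal_form_equiv_iff:
  fixes b1 b2 :: "'a::{alg_closed_field,field_char_0}"
  assumes "k \<ge> 1"
  shows "equiv_form (2 * k + 1) (normal_form (2 * k + 1) b1) (normal_form (2 * k + 1) b2)
    \<longleftrightarrow> b1 = b2 \<or> b1 = - b2" (is "equiv_form ?n ?c ?d \<longleftrightarrow> _")
proof
  assume "b1 = b2 \<or> b1 = - b2"
  then show "equiv_form ?n ?c ?d"
    using normal_form_uminus[OF assms, of b1] equiv_form_refl by auto
next
  assume "equiv_form ?n ?c ?d"
  then obtain \<sigma> where u: "uniformizer \<sigma>" and "\<forall>f. coeff_form ?n ?c (vf_subst \<sigma> f) = coeff_form ?n ?d f"
    by (auto simp: equiv_form_def)
  then have eq: "coeff_form ?n ?c (vf_subst \<sigma> (fps_X ^ i)) = ?d i" if "i \<le> ?n" for i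
    using that by (simp add: coeff_form_X_power)
  let ?r = "fps_nth \<sigma> 1"
  have r: "?r \<noteq> 0" using u by (simp add: uniformizer_def)
  have gap: "fps_nth \<sigma> j = 0" if "2 \<le> j" "j \<le> k" for j
    using that
  proof (induction j rule: less_induct)
    case (less j)
    define l where "l = j - 1"
    have l: "0 < l" "l < k" "j = l + 1" "l \<le> ?n" using less.prems by (auto simp: l_def)
    have "fps_nth \<sigma> i = 0" if "2 \<le> i" "i \<le> l" for i using less that l by auto
    note sub = coeff_form_subst_gap(2)[OF u l(1) this l(4), where c = ?c]
    have "?c (?n - l) = 0" "?d (?n - l) = 0" "?c ?n = 1"
      using l by (auto simp: normal_form_def)
    then have "(of_nat ?n - 2 * of_nat l - 1) * fps_nth \<sigma> j * ?r ^ (?n - l) / ?r ^ 2 = 0"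
      using sub eq[of "?n - l"] l(3) by simp
    moreover have "of_nat ?n - 2 * of_nat l - 1 = (of_nat (2 * (k - l)) :: 'a)"
      using l by (simp add: of_nat_diff algebra_simps)
    then have "of_nat ?n - 2 * of_nat l - 1 \<noteq> (0 :: 'a)"
      using l by simp
    ultimately show ?case using r by simp
  qed
  have "0 < k" "k \<le> ?n" using assms by auto
  note sub = coeff_form_subst_gap(2)[OF u this(1) gap this(2), where c = ?c]
  have "?n - k = k + 1" by simp
  moreover have "?c (k + 1) = b1" "?d (k + 1) = b2" using assms by (auto simp: normal_form_def)
  moreover have "of_nat ?n - 2 * of_nat k - 1 = (0 :: 'a)" by simp
  ultimately have 1: "b2 = b1 * ?r ^ k" using sub eq[of "?n - k"] r by simp
  have "?r ^ (2 * k) = 1"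
    using coeff_form_subst_top[OF u, of ?n ?c] eq[of ?n] r by (simp add: normal_form_def)
  then have "(?r ^ k) ^ 2 = 1" by (simp add: power_mult[symmetric] mult.commute)
  then have "?r ^ k = 1 \<or> ?r ^ k = -1" by (simp add: power2_eq_1_iff)
  then show "b1 = b2 \<or> b1 = - b2" using 1 by auto
qed

lemma equiv_form_one_invariant:
  assumes "equiv_form 1 c d" shows "c 1 = d 1"
proof -
  obtain \<sigma> where u: "uniformizer \<sigma>" and "\<forall>f. coeff_form 1 c (vf_subst \<sigma> f) = coeff_form 1 d f"
    using assms by (auto simp: equiv_form_def)
  then have "coeff_form 1 c (vf_subst \<sigma> (fps_X ^ 1)) = d 1" by (simp only: coeff_form_X_power) simp
  then show "c 1 = d 1" using coeff_form_subst_top[OF u, of 1 c] u by (simp add: uniformizer_def)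
qed

lemma equiv_form_one:
  fixes c d :: "nat \<Rightarrow> 'a::field_char_0"
  assumes "c 1 \<noteq> 0"
  shows "equiv_form 1 c d \<longleftrightarrow> c 1 = d 1"
proof
  show "c 1 = d 1" if "equiv_form 1 c d" using that by (rule equiv_form_one_invariant)
next
  assume eq: "c 1 = d 1"
  have *: "equiv_form 1 c (\<lambda>i. if i = 1 then c 1 else 0)" if "c 1 \<noteq> 0" for c :: "nat \<Rightarrow> 'a"
  proof -
    obtain e where e: "equiv_form 1 c e" "e 1 = c 1" "\<forall>i<1. 1 + 1 \<noteq> 2 * i \<longrightarrow> e i = 0"
      using eliminate_lower_coefficients[of c 1] \<open>c 1 \<noteq> 0\<close> by auto
    show ?thesis
      by (rule equiv_form_cong[OF e(1)]) (use e in \<open>auto simp: le_Suc_eq\<close>)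
  qed
  show "equiv_form 1 c d"
    using *[of c] *[of d] eq assms by (metis (no_types) equiv_form_trans equiv_form_sym)
qed

section \<open>The residue of the square root\<close>

text \<open>
  Invariance of the residue of \<open>g du / u\<^sup>N\<close> under \<open>u = \<tau>\<close>. It is written with power series by factoring
  \<open>\<tau> = u v\<close>, so that \<open>u\<^sup>N / \<tau>\<^sup>N = v\<^bsup>-N\<^esup>\<close> and the residue becomes the coefficient at \<open>u\<^bsup>N-1\<^esup>\<close>. For a monomial
  \<open>g = u\<^sup>i\<close> with \<open>i < N - 1\<close> the differential \<open>\<tau>\<^bsup>i-N\<^esup> d\<tau>\<close> is exact, and for \<open>i = N - 1\<close> it is \<open>d\<tau> / \<tau>\<close>, with
  residue \<open>1\<close>.
\<close>

lemma fps_residue_substitution: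
  fixes g \<tau> :: "'a::field_char_0 fps"
  assumes "uniformizer \<tau>" "0 < N"
  shows "fps_nth (fps_compose g \<tau> * (inverse (fps_shift 1 \<tau>) ^ N * fps_deriv \<tau>)) (N - 1) = fps_nth g (N - 1)"
proof -
  let ?v = "fps_shift 1 \<tau>"
  have t0: "fps_nth \<tau> 0 = 0" and v0: "fps_nth ?v 0 \<noteq> 0" using assms(1) by (auto simp: uniformizer_def)
  have vv: "?v * inverse ?v = 1" using v0 by (simp add: inverse_mult_eq_1')
  have fac: "\<tau> = fps_X * ?v" by (rule uniformizer_factor[OF assms(1)])
  have deriv: "fps_deriv \<tau> = ?v + fps_X * fps_deriv ?v"
    by (subst fac) simp
  have main: "fps_nth (\<tau> ^ i * (inverse ?v ^ N * fps_deriv \<tau>)) (N - 1) = (if i = N - 1 then 1 else 0)"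
    if "i \<le> N - 1" for i
  proof -
    define p where "p = N - i"
    have p: "0 < p" "N = i + p" using that assms(2) by (auto simp: p_def)
    have "\<tau> ^ i = fps_X ^ i * ?v ^ i" by (metis fac power_mult_distrib)
    then have "\<tau> ^ i * (inverse ?v ^ N * fps_deriv \<tau>) = fps_X ^ i * ((?v * inverse ?v) ^ i * (inverse ?v ^ p * fps_deriv \<tau>))"
      unfolding p(2) by (simp only: power_mult_distrib power_add mult_ac)
    also have "\<dots> = fps_X ^ i * (inverse ?v ^ p * fps_deriv \<tau>)" by (simp only: vv power_one mult_1_left)
    finally have "fps_nth (\<tau> ^ i * (inverse ?v ^ N * fps_deriv \<tau>)) (N - 1)
        = fps_nth (inverse ?v ^ p * fps_deriv \<tau>) (N - 1 - i)"
      using p by (simp only: fps_X_power_mult_nth) simp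
    also have "N - 1 - i = p - 1" using p by simp
    finally have "fps_nth (\<tau> ^ i * (inverse ?v ^ N * fps_deriv \<tau>)) (N - 1)
        = fps_nth (inverse ?v ^ p * fps_deriv \<tau>) (p - 1)" .
    also have "\<dots> = (if p = 1 then 1 else 0)"
    proof (cases "p = 1")
      case True
      then show ?thesis using v0 by simp
    next
      case False
      define r where "r = p - 1"
      have r: "p = Suc r" "0 < r" using p False by (auto simp: r_def)
      let ?w = "inverse ?v ^ r"
      obtain q where q: "r = Suc q" using r(2) gr0_conv_Suc by blast
      \<comment> \<open>Up to the factor \<open>r\<close>, \<open>v\<^bsup>-p\<^esup> \<tau>'\<close> is \<open>r w - u w'\<close> with \<open>w = v\<^bsup>-r\<^esup>\<close>, which has no term at \<open>u\<^sup>r\<close>.\<close>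
      have dw: "fps_deriv ?w = - of_nat r * (inverse ?v ^ p * fps_deriv ?v)"
      proof -
        have "fps_deriv ?w = of_nat r * (- fps_deriv ?v * (inverse ?v)\<^sup>2) * inverse ?v ^ q"
          unfolding fps_deriv_power' fps_inverse_deriv[OF v0] q by (simp only: diff_Suc_1)
        also have "\<dots> = - of_nat r * ((inverse ?v)\<^sup>2 * inverse ?v ^ q * fps_deriv ?v)"
          by (simp only: mult_minus_left mult_minus_right mult_ac)
        also have "(inverse ?v)\<^sup>2 * inverse ?v ^ q = inverse ?v ^ p"
          by (simp only: r(1) q flip: power_add) simp
        finally show ?thesis .
      qed
      have "inverse ?v ^ p * ?v = ?w * (?v * inverse ?v)"
        by (simp only: r(1) power_Suc mult_ac)
      then have "inverse ?v ^ p * ?v = ?w" by (simp only: vv mult_1_right)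
      then have eq: "of_nat r * (inverse ?v ^ p * fps_deriv \<tau>) = of_nat r * ?w - fps_X * fps_deriv ?w"
        unfolding dw deriv by (simp only: distrib_left mult_minus_left mult_minus_right diff_minus_eq_add mult_ac)
      have "of_nat r * fps_nth (inverse ?v ^ p * fps_deriv \<tau>) r
          = fps_nth (of_nat r * (inverse ?v ^ p * fps_deriv \<tau>)) r"
        by (simp add: fps_mult_of_nat_nth)
      also have "\<dots> = 0"
        unfolding eq using r by (simp add: fps_mult_of_nat_nth)
      finally show ?thesis using r by simp
    qed
    finally show ?thesis using p by auto
  qed
  have "fps_nth (fps_compose g \<tau> * (inverse ?v ^ N * fps_deriv \<tau>)) (N - 1)
      = (\<Sum>i\<le>N - 1. fps_nth g i * (if i = N - 1 then 1 else 0))"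
    unfolding fps_compose_mult_nth[OF t0] by (intro sum.cong refl) (simp only: main atMost_iff)
  also have "\<dots> = fps_nth g (N - 1)" by (simp add: sum.If_cases if_distrib cong: if_cong)
  finally show ?thesis .
qed

text \<open>
  The polar part \<open>\<Sum>i\<le>n. c i u\<^bsup>-i-1\<^esup>\<close> with \<open>n = 2 k + 1\<close> agrees down to \<open>u\<^bsup>-k-2\<^esup>\<close> with the square of
  \<open>b 0 u\<^bsup>-k-1\<^esup> + \<dots> + b k u\<^bsup>-1\<^esup>\<close>. The remaining coefficients, which would involve higher terms of the
  square root, do not affect its residue \<open>b k = \<beta>\<close>.
\<close>

definition square_root_residue :: "nat \<Rightarrow> 'a::field \<Rightarrow> (nat \<Rightarrow> 'a) \<Rightarrow> bool" where
  "square_root_residue k \<beta> c \<longleftrightarrow> (\<exists>b. b 0 \<noteq> 0 \<and> b k = \<beta> \<and>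
     (\<forall>l\<le>k. c (2 * k + 1 - l) = (\<Sum>i\<le>l. b i * b (l - i))))"

text \<open>
  The normal form has the square root \<open>(u\<^bsup>-k-1\<^esup> + \<beta> u\<^bsup>-1\<^esup>) du\<close>, written \<open>u\<^bsup>-k-1\<^esup> g du\<close> below. Its transform
  \<open>u\<^bsup>-k-1\<^esup> B du\<close> under the inverse \<open>\<tau>\<close> of \<open>\<sigma>\<close> is a square root for the transformed functional, and both
  this and the equality of the residues follow from the invariance of residues.
\<close>

lemma normal_form_orbit_residue:
  fixes \<beta> :: "'a::field_char_0"
  assumes "k \<ge> 1" "equiv_form (2 * k + 1) (normal_form (2 * k + 1) (2 * \<beta>)) c"
  shows "square_root_residue k \<beta> c"
proof -
  define n where "n = 2 * k + 1"
  obtain \<sigma> where u: "uniformizer \<sigma>"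
    and \<sigma>: "\<And>f. coeff_form n (normal_form n (2 * \<beta>)) (vf_subst \<sigma> f) = coeff_form n c f"
    using assms(2) by (auto simp: equiv_form_def n_def)
  define \<tau> where "\<tau> = fps_inv \<sigma>"
  have ut: "uniformizer \<tau>" using uniformizer_inv[OF u] by (simp add: \<tau>_def)
  have t0: "fps_nth \<tau> 0 = 0" using ut by (simp add: uniformizer_def)
  define v where "v = fps_shift 1 \<tau>"
  have v0: "fps_nth v 0 \<noteq> 0" using ut by (simp add: uniformizer_def v_def)
  define g where "g = 1 + fps_const \<beta> * fps_X ^ k"
  define B where "B = fps_compose g \<tau> * (inverse v ^ (k + 1) * fps_deriv \<tau>)"
  have "fps_nth B 0 \<noteq> 0"
    using assms(1) v0 uniformizer_deriv[OF ut] by (simp add: B_def g_def fps_nth_power_0 power_0_left)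
  moreover have "fps_nth B k = \<beta>"
    using fps_residue_substitution[OF ut, of "k + 1" g] assms(1) by (simp add: B_def g_def v_def)
  moreover have "c (n - l) = (\<Sum>i\<le>l. fps_nth B i * fps_nth B (l - i))" if "l \<le> k" for l
  proof -
    define i where "i = n - l"
    have i: "i \<le> n" "n - i = l" "1 < i" using that assms(1) by (auto simp: i_def n_def)
    define h where "h = vf_subst \<sigma> (fps_X ^ i)"
    have "vf_subst \<tau> h = fps_X ^ i" by (simp add: h_def \<tau>_def vf_subst_inv(2)[OF u])
    then have "fps_compose h \<tau> * (inverse (fps_deriv \<tau>) * fps_deriv \<tau>) = fps_X ^ i * fps_deriv \<tau>"
      by (simp add: vf_subst_def flip: mult.assoc)
    then have h\<tau>: "fps_compose h \<tau> = fps_X ^ i * fps_deriv \<tau>"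
      by (simp only: inverse_mult_eq_1[OF uniformizer_deriv[OF ut]] mult_1_right)
    have "fps_nth (fps_X ^ i * B\<^sup>2) n = fps_nth (B\<^sup>2) l"
      using i by (simp only: fps_X_power_mult_nth) simp
    also have "\<dots> = (\<Sum>i\<le>l. fps_nth B i * fps_nth B (l - i))"
      by (simp add: power2_eq_square fps_mult_nth atLeast0AtMost)
    finally have sumB: "(\<Sum>i\<le>l. fps_nth B i * fps_nth B (l - i)) = fps_nth (fps_X ^ i * B\<^sup>2) n" ..
    have "inverse v ^ (n + 1) = inverse v ^ (k + 1) * inverse v ^ (k + 1)"
      by (simp only: n_def flip: power_add) (simp add: mult_2)
    then have "fps_X ^ i * B\<^sup>2 = (fps_compose g \<tau>)\<^sup>2 * (fps_X ^ i * fps_deriv \<tau>) * (inverse v ^ (n + 1) * fps_deriv \<tau>)"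
      unfolding B_def by (simp only: power2_eq_square mult_ac)
    also have "\<dots> = fps_compose (g\<^sup>2 * h) \<tau> * (inverse v ^ (n + 1) * fps_deriv \<tau>)"
      by (simp only: h\<tau>[symmetric] fps_compose_mult_distrib[OF t0] fps_compose_power[OF t0])
    finally have "fps_nth (fps_X ^ i * B\<^sup>2) n = fps_nth (g\<^sup>2 * h) n"
      using fps_residue_substitution[OF ut, of "n + 1" "g\<^sup>2 * h"] by (simp add: v_def)
    \<comment> \<open>The last term below contributes the coefficient of \<open>h\<close> at \<open>u\<close>, which is \<open>0\<close> because \<open>h\<close> vanishes to order \<open>i > 1\<close>.\<close>
    also have "g\<^sup>2 * h = h + fps_const (2 * \<beta>) * (fps_X ^ k * h) + fps_const (\<beta>\<^sup>2) * (fps_X ^ (2 * k) * h)"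
    proof -
      have "(1 + C * u)\<^sup>2 * h = h + (2 * C) * (u * h) + (C * C) * ((u * u) * h)" for C u :: "'a fps"
        by (simp add: power2_eq_square algebra_simps mult_2)
      moreover have "2 * fps_const \<beta> = fps_const (2 * \<beta>)" by (simp add: numeral_fps_const)
      moreover have "fps_const \<beta> * fps_const \<beta> = fps_const (\<beta>\<^sup>2)" by (simp add: power2_eq_square)
      moreover have "fps_X ^ k * fps_X ^ k = (fps_X ^ (2 * k) :: 'a fps)" by (simp add: mult_2 power_add)
      ultimately show ?thesis unfolding g_def by (simp only:)
    qed
    also have "fps_nth \<dots> n = fps_nth h n + 2 * \<beta> * fps_nth h (k + 1)"
      using vf_subst_nth_lower[OF u i(3)] by (simp add: fps_X_power_mult_nth n_def h_def)
    also have "\<dots> = coeff_form n (normal_form n (2 * \<beta>)) h"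
    proof -
      have "coeff_form n (normal_form n (2 * \<beta>)) h
          = (\<Sum>j\<in>{k + 1, n}. normal_form n (2 * \<beta>) j * fps_nth h j)"
        unfolding coeff_form_def
        by (intro sum.mono_neutral_right) (auto simp: normal_form_def n_def)
      then show ?thesis using assms(1) by (simp add: normal_form_def n_def)
    qed
    also have "\<dots> = c (n - l)"
      using i by (simp add: h_def \<sigma> coeff_form_X_power i_def)
    finally show ?thesis using sumB by simp
  qed
  ultimately show ?thesis unfolding square_root_residue_def n_def by blast
qed

lemma convolution_split:
  fixes b :: "nat \<Rightarrow> 'a::field"
  assumes "0 < l"
  shows "(\<Sum>i\<le>l. b i * b (l - i)) = 2 * b 0 * b l + (\<Sum>i\<in>{1..<l}. b i * b (l - i))"
proof -
  have "{..l} = insert 0 (insert l {1..<l})" using assms by auto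
  then show ?thesis using assms by simp
qed

text \<open>
  The equation for \<open>c (2 * k + 1 - l)\<close> is linear in \<open>b l\<close>, with leading coefficient \<open>2 * b 0\<close>. So \<open>c\<close>
  determines \<open>b\<close> once the sign of \<open>b 0\<close> is chosen.
\<close>

lemma square_root_residue_unique:
  fixes \<beta> \<gamma> :: "'a::field_char_0"
  assumes "square_root_residue k \<beta> c" "square_root_residue k \<gamma> c"
  shows "\<beta> = \<gamma> \<or> \<beta> = - \<gamma>"
proof -
  obtain b where b: "b 0 \<noteq> 0" "b k = \<beta>" "\<forall>l\<le>k. c (2 * k + 1 - l) = (\<Sum>i\<le>l. b i * b (l - i))"
    using assms(1) unfolding square_root_residue_def by blast
  obtain d where d: "d 0 \<noteq> 0" "d k = \<gamma>" "\<forall>l\<le>k. c (2 * k + 1 - l) = (\<Sum>i\<le>l. d i * d (l - i))"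
    using assms(2) unfolding square_root_residue_def by blast
  have eq: "(\<Sum>i\<le>l. b i * b (l - i)) = (\<Sum>i\<le>l. d i * d (l - i))" if "l \<le> k" for l
    using b(3) d(3) that by metis
  from eq[of 0] have "b 0 = d 0 \<or> b 0 = - d 0" by (simp add: square_eq_iff)
  then obtain s where s: "b 0 = s * d 0" "s = 1 \<or> s = -1" "s * s = 1" by force
  have "b l = s * d l" if "l \<le> k" for l
    using that
  proof (induction l rule: less_induct)
    case (less l)
    show ?case
    proof (cases "l = 0")
      case False
      have "(\<Sum>i\<in>{1..<l}. b i * b (l - i)) = (\<Sum>i\<in>{1..<l}. d i * d (l - i))"
      proof (rule sum.cong[OF refl])
        fix i assume "i \<in> {1..<l}"
        then have "b i * b (l - i) = (s * s) * (d i * d (l - i))"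
          using less by (simp add: mult_ac)
        then show "b i * b (l - i) = d i * d (l - i)" by (simp only: s(3) mult_1_left)
      qed
      then have "b 0 * b l = d 0 * d l"
        using eq[OF less.prems] False by (simp add: convolution_split)
      then have "d 0 * (s * b l) = d 0 * d l" by (simp add: s(1) mult_ac)
      then have "s * b l = d l" using d(1) by simp
      then show ?thesis by (metis s(3) mult.assoc mult_1_left)
    qed (use s in simp)
  qed
  then show ?thesis using b d s(2) by auto
qed

text \<open>
  Conversely, a functional with residue \<open>\<beta>\<close> has some normal form; by the invariance of the residue it is
  the expected one, up to a sign that does not change the orbit.
\<close>

theorem equiv_normal_form_iff_residue:
  fixes \<beta> :: "'a::{alg_closed_field,field_char_0}"
  assumes "k \<ge> 1"
  shows "equiv_form (2 * k + 1) (normal_form (2 * k + 1) (2 * \<beta>)) c \<longleftrightarrow> square_root_residue k \<beta> c"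
    (is "?E \<longleftrightarrow> ?R")
proof
  assume ?E then show ?R by (rule normal_form_orbit_residue[OF assms])
next
  assume R: ?R
  then have "c (2 * k + 1) \<noteq> 0" by (fastforce simp: square_root_residue_def)
  moreover have "2 * k + 1 \<noteq> 1" using assms by simp
  ultimately obtain b' where "equiv_form (2 * k + 1) c (normal_form (2 * k + 1) b')"
    using equiv_normal_form by blast
  then have e: "equiv_form (2 * k + 1) (normal_form (2 * k + 1) (2 * (b' / 2))) c"
    by (simp add: equiv_form_sym)
  from square_root_residue_unique[OF R normal_form_orbit_residue[OF assms e]]
  have "2 * \<beta> = 2 * (b' / 2) \<or> 2 * \<beta> = - (2 * (b' / 2))" by auto
  then have "equiv_form (2 * k + 1) (normal_form (2 * k + 1) (2 * \<beta>)) (normal_form (2 * k + 1) (2 * (b' / 2)))"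
    by (simp only: normal_form_equiv_iff[OF assms])
  then show ?E using e by (rule equiv_form_trans)
qed

section \<open>Algebraic independence by counting monomials\<close>

interpretation fun_space: vector_space "\<lambda>(c::'a::field) (f::'b \<Rightarrow> 'a) y. c * f y"
  by unfold_locales (auto simp: fun_eq_iff algebra_simps)

text \<open>
  Polynomials in the first \<open>N\<close> coordinates, as functions on the space of all sequences; this way
  the number of variables is not tied to a type.
\<close>

inductive_set polyfun :: "nat \<Rightarrow> ((nat \<Rightarrow> 'a::field) \<Rightarrow> 'a) set" for N where
  const: "(\<lambda>_. c) \<in> polyfun N"
| coord: "i < N \<Longrightarrow> (\<lambda>y. y i) \<in> polyfun N"
| add: "f \<in> polyfun N \<Longrightarrow> g \<in> polyfun N \<Longrightarrow> (\<lambda>y. f y + g y) \<in> polyfun N"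
| mult: "f \<in> polyfun N \<Longrightarrow> g \<in> polyfun N \<Longrightarrow> (\<lambda>y. f y * g y) \<in> polyfun N"

definition monomials :: "nat \<Rightarrow> nat \<Rightarrow> ((nat \<Rightarrow> 'a::field) \<Rightarrow> 'a) set" where
  "monomials N D = (\<lambda>e y. \<Prod>i<N. y i ^ e i) ` ({..<N} \<rightarrow>\<^sub>E {..D})"

lemma finite_monomials: "finite (monomials N D)"
  unfolding monomials_def by (intro finite_imageI finite_PiE) auto

lemma card_monomials: "card (monomials N D) \<le> (D + 1) ^ N"
proof -
  have "card (monomials N D) \<le> card ({..<N} \<rightarrow>\<^sub>E {..D})"
    unfolding monomials_def by (intro card_image_le finite_PiE) auto
  also have "\<dots> = (D + 1) ^ N" by (simp add: card_PiE)
  finally show ?thesis .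
qed

lemma monomial_in_monomials: "(\<And>i. i < N \<Longrightarrow> e i \<le> D) \<Longrightarrow> (\<lambda>y. \<Prod>i<N. y i ^ e i) \<in> monomials N D"
  unfolding monomials_def by (rule image_eqI[of _ _ "restrict e {..<N}"]) auto

lemma monomialsE:
  assumes "m \<in> monomials N D"
  obtains e where "m = (\<lambda>y. \<Prod>i<N. y i ^ e i)" "\<forall>i<N. e i \<le> D"
  using assms unfolding monomials_def by (auto simp: PiE_iff)

lemma monomials_mono: "D \<le> E \<Longrightarrow> monomials N D \<subseteq> monomials N E"
  by (auto elim!: monomialsE intro!: monomial_in_monomials intro: order_trans)

lemma monomials_mult:
  assumes "f \<in> monomials N D" "g \<in> monomials N E"
  shows "(\<lambda>y. f y * g y) \<in> monomials N (D + E)"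
proof -
  obtain d where "f = (\<lambda>y. \<Prod>i<N. y i ^ d i)" "\<forall>i<N. d i \<le> D"
    using assms(1) by (rule monomialsE)
  moreover obtain e where "g = (\<lambda>y. \<Prod>i<N. y i ^ e i)" "\<forall>i<N. e i \<le> E"
    using assms(2) by (rule monomialsE)
  ultimately show ?thesis
    using monomial_in_monomials[of N "\<lambda>i. d i + e i" "D + E"]
    by (simp add: power_add prod.distrib add_mono)
qed

lemma span_mult:
  assumes "f \<in> fun_space.span S" "g \<in> fun_space.span T"
    "\<And>s t. s \<in> S \<Longrightarrow> t \<in> T \<Longrightarrow> (\<lambda>y. s y * t y) \<in> U"
  shows "(\<lambda>y. f y * g y) \<in> fun_space.span U"
  using assms(1)
proof (induction rule: fun_space.span_induct_alt)
  case base
  have "(\<lambda>y. (0 :: 'a \<Rightarrow> 'b) y * g y) = 0" by auto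
  then show ?case by (simp only: fun_space.span_zero)
next
  case (step c s f)
  have "(\<lambda>y. s y * g y) \<in> fun_space.span U"
    using assms(2)
  proof (induction rule: fun_space.span_induct_alt)
    case base
    have "(\<lambda>y. s y * (0 :: 'a \<Rightarrow> 'b) y) = 0" by auto
    then show ?case by (simp only: fun_space.span_zero)
  next
    case (step c t g)
    have "(\<lambda>y. s y * ((\<lambda>y. c * t y) + g) y) = (\<lambda>y. c * (s y * t y)) + (\<lambda>y. s y * g y)"
      by (auto simp: algebra_simps)
    then show ?case
      using step assms(3)[OF \<open>s \<in> S\<close>]
      by (simp only: fun_space.span_add fun_space.span_scale fun_space.span_base)
  qed
  moreover have "(\<lambda>y. ((\<lambda>y. c * s y) + f) y * g y) = (\<lambda>y. c * (s y * g y)) + (\<lambda>y. f y * g y)"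
    by (auto simp: algebra_simps)
  ultimately show ?case
    using step by (simp only: fun_space.span_add fun_space.span_scale)
qed

lemma span_monomials_mono:
  "f \<in> fun_space.span (monomials N D) \<Longrightarrow> D \<le> E \<Longrightarrow> f \<in> fun_space.span (monomials N E)"
  using fun_space.span_mono[OF monomials_mono] by blast

lemma polyfun_in_span:
  assumes "f \<in> polyfun N" shows "\<exists>D. f \<in> fun_space.span (monomials N D)"
  using assms
proof induction
  case (const c)
  have "(\<lambda>y. c * 1) \<in> fun_space.span (monomials N 0)"
    using monomial_in_monomials[of N "\<lambda>_. 0" 0]
    by (intro fun_space.span_scale fun_space.span_base) simp
  then show ?case by auto
next
  case (coord i)
  have "(\<lambda>y::nat \<Rightarrow> 'a. \<Prod>j<N. y j ^ (if j = i then 1 else 0)) \<in> monomials N 1"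
    by (rule monomial_in_monomials) auto
  moreover have "(\<Prod>j<N. y j ^ (if j = i then 1 else 0)) = y i" for y :: "nat \<Rightarrow> 'a"
    using coord by (simp add: if_distrib cong: if_cong)
  ultimately show ?case using fun_space.span_base by (metis (no_types, lifting) ext)
next
  case (add f g)
  then obtain D E where "f \<in> fun_space.span (monomials N D)" "g \<in> fun_space.span (monomials N E)" by auto
  then have "f \<in> fun_space.span (monomials N (max D E))" "g \<in> fun_space.span (monomials N (max D E))"
    by (auto intro: span_monomials_mono)
  from fun_space.span_add[OF this] show ?case unfolding plus_fun_def by blast
next
  case (mult f g)
  then show ?case using span_mult monomials_mult by blast
qed

lemma one_in_span_monomials: "(\<lambda>_. 1) \<in> fun_space.span (monomials N D)"
  using monomial_in_monomials[of N "\<lambda>_. 0" D] by (intro fun_space.span_base) simp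

lemma span_monomials_power:
  assumes "f \<in> fun_space.span (monomials N D)" "a \<le> R"
  shows "(\<lambda>y. f y ^ a) \<in> fun_space.span (monomials N (R * D))"
proof -
  have "(\<lambda>y. f y ^ a) \<in> fun_space.span (monomials N (a * D))"
  proof (induction a)
    case 0
    show ?case by (simp add: one_in_span_monomials)
  next
    case (Suc a)
    then show ?case using span_mult[OF assms(1) Suc monomials_mult] by simp
  qed
  then show ?thesis by (rule span_monomials_mono) (simp add: assms(2))
qed

lemma span_monomials_prod:
  assumes "\<And>i. i < M \<Longrightarrow> f i \<in> fun_space.span (monomials N D)"
  shows "(\<lambda>y. \<Prod>i<M. f i y) \<in> fun_space.span (monomials N (M * D))"
  using assms
proof (induction M)
  case 0
  show ?case by (simp add: one_in_span_monomials)
next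
  case (Suc M)
  have "(\<lambda>y. f M y * (\<Prod>i<M. f i y)) \<in> fun_space.span (monomials N (D + M * D))"
    using Suc by (intro span_mult[OF _ _ monomials_mult]) auto
  then show ?case by (simp add: mult.commute)
qed

lemma sum_fun_apply: "(\<Sum>a\<in>A. f a) y = (\<Sum>a\<in>A. f a y)"
  for f :: "'c \<Rightarrow> 'b \<Rightarrow> 'a::comm_monoid_add"
  by (induction A rule: infinite_finite_induct) auto

lemma linear_relation_of_card:
  fixes g :: "'c \<Rightarrow> 'b \<Rightarrow> 'a::field"
  assumes "finite A" "finite T" "card T < card A" "\<And>a. a \<in> A \<Longrightarrow> g a \<in> fun_space.span T"
  shows "\<exists>c. (\<exists>a\<in>A. c a \<noteq> 0) \<and> (\<forall>y. (\<Sum>a\<in>A. c a * g a y) = 0)"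
proof (cases "inj_on g A")
  case True
  have "fun_space.dependent (g ` A)"
  proof (rule ccontr)
    assume "fun_space.independent (g ` A)"
    then have "card (g ` A) \<le> card T"
      using fun_space.independent_span_bound[OF assms(2)] assms(4) by blast
    then show False using assms(3) by (simp add: card_image[OF True])
  qed
  then obtain u where u: "\<exists>v\<in>g ` A. u v \<noteq> 0" "(\<Sum>v\<in>g ` A. (\<lambda>y. u v * v y)) = 0"
    using fun_space.dependent_finite[of "g ` A"] assms(1) by auto
  have "(\<Sum>a\<in>A. u (g a) * g a y) = 0" for y
  proof -
    have "(\<Sum>v\<in>g ` A. (\<lambda>y. u v * v y)) y = 0" by (simp only: u(2) zero_fun_def)
    then show ?thesis by (simp add: sum_fun_apply sum.reindex[OF True])
  qed
  then show ?thesis using u(1) by (intro exI[of _ "\<lambda>a. u (g a)"]) auto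
next
  case False
  then obtain a b where ab: "a \<in> A" "b \<in> A" "a \<noteq> b" "g a = g b" by (auto simp: inj_on_def)
  define c :: "'c \<Rightarrow> 'a" where "c = (\<lambda>x. if x = a then 1 else if x = b then -1 else 0)"
  have "(\<Sum>x\<in>A. c x * g x y) = 0" for y
  proof -
    have "(\<Sum>x\<in>A. c x * g x y) = (\<Sum>x\<in>{a, b}. c x * g x y)"
      using ab assms(1) by (intro sum.mono_neutral_right) (auto simp: c_def)
    then show ?thesis using ab by (simp add: c_def)
  qed
  then show ?thesis using ab(1) by (intro exI[of _ c]) (auto simp: c_def)
qed

text \<open>
  There are \<open>R\<^sup>M\<close> products of powers below \<open>R\<close> of the \<open>f i\<close>. Their degrees grow linearly with \<open>R\<close>, so they
  lie in a space of dimension \<open>O(R\<^sup>N)\<close>, and for large \<open>R\<close> they are linearly dependent.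
\<close>

lemma algebraic_relation:
  assumes "\<And>i. i < M \<Longrightarrow> f i \<in> polyfun N" "N < M"
  shows "\<exists>R c. (\<exists>a\<in>{..<M} \<rightarrow>\<^sub>E {..<R}. c a \<noteq> 0) \<and>
    (\<forall>y. (\<Sum>a\<in>{..<M} \<rightarrow>\<^sub>E {..<R}. c a * (\<Prod>i<M. f i y ^ a i)) = 0)"
proof -
  have "\<forall>i. \<exists>D. i < M \<longrightarrow> f i \<in> fun_space.span (monomials N D)"
    using polyfun_in_span assms(1) by blast
  then obtain d where d: "\<And>i. i < M \<Longrightarrow> f i \<in> fun_space.span (monomials N (d i))" by metis
  define D where "D = (\<Sum>i<M. d i)"
  have fD: "f i \<in> fun_space.span (monomials N D)" if "i < M" for i
  proof -
    have "d i \<le> D" unfolding D_def using that by (intro member_le_sum) auto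
    then show ?thesis using span_monomials_mono[OF d[OF that]] by blast
  qed
  \<comment> \<open>This \<open>R\<close> satisfies \<open>(M R D + 1)\<^sup>N \<le> R\<^sup>N B\<^sup>N < R\<^bsup>N+1\<^esup> \<le> R\<^sup>M\<close>.\<close>
  define B where "B = M * D + 1"
  define R where "R = B ^ N + 1"
  let ?A = "{..<M} \<rightarrow>\<^sub>E {..<R}" and ?T = "monomials N (M * (R * D)) :: ((nat \<Rightarrow> 'a) \<Rightarrow> 'a) set"
  have "card ?T \<le> (M * (R * D) + 1) ^ N" by (rule card_monomials)
  also have "\<dots> \<le> (R * B) ^ N"
    by (intro power_mono) (simp_all add: B_def R_def algebra_simps)
  also have "\<dots> = R ^ N * B ^ N" by (rule power_mult_distrib)
  also have "\<dots> < R ^ N * R" by (intro mult_strict_left_mono zero_less_power) (simp_all add: R_def)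
  also have "\<dots> = R ^ (N + 1)" by simp
  also have "\<dots> \<le> R ^ M" using assms(2) by (intro power_increasing) (auto simp: R_def)
  also have "\<dots> = card ?A" by (simp add: card_PiE)
  finally have "card ?T < card ?A" .
  moreover have "finite ?A" by (intro finite_PiE) auto
  moreover have "(\<lambda>y. \<Prod>i<M. f i y ^ a i) \<in> fun_space.span ?T" if "a \<in> ?A" for a
  proof (rule span_monomials_prod)
    fix i assume "i < M"
    then have "a i < R" using that by auto
    then show "(\<lambda>y. f i y ^ a i) \<in> fun_space.span (monomials N (R * D))"
      using span_monomials_power[OF fD[OF \<open>i < M\<close>], of "a i" R] by simp
  qed
  ultimately have "\<exists>c. (\<exists>a\<in>?A. c a \<noteq> 0) \<and> (\<forall>y. (\<Sum>a\<in>?A. c a * (\<Prod>i<M. f i y ^ a i)) = 0)"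
    using finite_monomials by (intro linear_relation_of_card[of ?A ?T])
  then show ?thesis by (rule exI)
qed

lemma polynomial_functions_sum:
  assumes "\<And>a. a \<in> A \<Longrightarrow> f a \<in> polynomial_functions V"
  shows "(\<lambda>v. \<Sum>a\<in>A. f a v) \<in> polynomial_functions V"
  using assms
  by (induction A rule: infinite_finite_induct) (auto intro: polynomial_functions.intros)

lemma polynomial_functions_prod:
  assumes "\<And>a. a \<in> A \<Longrightarrow> f a \<in> polynomial_functions V"
  shows "(\<lambda>v. \<Prod>a\<in>A. f a v) \<in> polynomial_functions V"
  using assms
  by (induction A rule: infinite_finite_induct) (auto intro: polynomial_functions.intros)

lemma polynomial_functions_power:
  "f \<in> polynomial_functions V \<Longrightarrow> (\<lambda>v. f v ^ k) \<in> polynomial_functions V"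
  by (induction k) (auto intro: polynomial_functions.intros)

lemma sum_PiE_Suc:
  "(\<Sum>a\<in>{..<Suc M} \<rightarrow>\<^sub>E {..<R::nat}. g a) = (\<Sum>j<R. \<Sum>a\<in>{..<M} \<rightarrow>\<^sub>E {..<R}. g (a(M := j)))"
proof -
  have "(\<Sum>a\<in>{..<Suc M} \<rightarrow>\<^sub>E {..<R}. g a)
      = (\<Sum>(j, a)\<in>{..<R} \<times> ({..<M} \<rightarrow>\<^sub>E {..<R}). g (a(M := j)))"
    unfolding lessThan_Suc PiE_insert_eq
    by (subst sum.reindex[OF inj_combinator]) (auto simp: case_prod_unfold)
  then show ?thesis by (simp add: sum.cartesian_product)
qed

text \<open>
  Functions \<open>p i\<close> that separate the consecutive members of a chain of irreducible sets are algebraically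
  independent on the largest one. In a relation, order the terms by the power of the last function
  \<open>p M\<close>. The lowest power can be cancelled because \<open>Z (Suc M)\<close> is irreducible; restricting to \<open>Z M\<close>, where
  \<open>p M\<close> vanishes, leaves a relation among the earlier functions for the lowest coefficient.
\<close>

lemma chain_algebraically_independent:
  fixes Z :: "nat \<Rightarrow> ('b \<Rightarrow> 'a::field) set" and R :: nat
  assumes integral: "\<And>i f g. i \<le> K \<Longrightarrow> f \<in> polynomial_functions V \<Longrightarrow> g \<in> polynomial_functions V \<Longrightarrow>
      (\<forall>z\<in>Z i. f z * g z = 0) \<Longrightarrow> (\<forall>z\<in>Z i. f z = 0) \<or> (\<forall>z\<in>Z i. g z = 0)"
    and ne: "Z 0 \<noteq> {}"
    and mono: "\<And>i. i < K \<Longrightarrow> Z i \<subseteq> Z (Suc i)"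
    and p: "\<And>i. i < K \<Longrightarrow> p i \<in> polynomial_functions V"
    and vanish: "\<And>i z. i < K \<Longrightarrow> z \<in> Z i \<Longrightarrow> p i z = 0"
    and nonzero: "\<And>i. i < K \<Longrightarrow> \<exists>z\<in>Z (Suc i). p i z \<noteq> 0"
  shows "M \<le> K \<Longrightarrow>
      \<forall>z\<in>Z M. (\<Sum>a\<in>{..<M} \<rightarrow>\<^sub>E {..<R}. c a * (\<Prod>i<M. p i z ^ a i)) = 0 \<Longrightarrow>
      \<forall>a\<in>{..<M} \<rightarrow>\<^sub>E {..<R}. c a = 0"
proof (induction M arbitrary: c)
  case 0
  then show ?case using ne by auto
next
  case (Suc M)
  let ?E = "{..<M} \<rightarrow>\<^sub>E {..<R}"
  define h where "h = (\<lambda>j z. \<Sum>a\<in>?E. c (a(M := j)) * (\<Prod>i<M. p i z ^ a i))"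
  have M: "M < K" "M \<le> K" "Suc M \<le> K" using Suc.prems by auto
  note poly = polynomial_functions.const polynomial_functions.mult polynomial_functions_sum
    polynomial_functions_prod polynomial_functions_power
  have hp: "h j \<in> polynomial_functions V" for j
    unfolding h_def using p M by (intro poly) auto
  have rel: "(\<Sum>j<R. h j z * p M z ^ j) = 0" if "z \<in> Z (Suc M)" for z
  proof -
    have "(\<Sum>a\<in>{..<Suc M} \<rightarrow>\<^sub>E {..<R}. c a * (\<Prod>i<Suc M. p i z ^ a i)) = 0"
      using Suc.prems(2) that by blast
    then show ?thesis unfolding sum_PiE_Suc h_def
      by (simp add: sum_distrib_right mult.assoc)
  qed
  have "\<forall>a\<in>?E. c (a(M := j)) = 0" if "j < R" for j
    using that
  proof (induction j rule: less_induct)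
    case (less j)
    have low: "h j' z = 0" if "j' < j" for j' z
    proof -
      have "\<forall>a\<in>?E. c (a(M := j')) = 0" using less.IH[OF that] that less.prems by (meson less_trans)
      then show ?thesis unfolding h_def by (intro sum.neutral ballI) (simp only: mult_zero_left)
    qed
    define r where "r = (\<lambda>z. \<Sum>i\<in>{j..<R}. h i z * p M z ^ (i - j))"
    have rp: "r \<in> polynomial_functions V" unfolding r_def using hp p[OF M(1)] by (intro poly)
    have "p M z ^ j * r z = 0" if "z \<in> Z (Suc M)" for z
    proof -
      have "p M z ^ j * r z = (\<Sum>i\<in>{j..<R}. h i z * p M z ^ i)"
        unfolding r_def sum_distrib_left
      proof (rule sum.cong[OF refl])
        fix i assume "i \<in> {j..<R}"
        then have "p M z ^ i = p M z ^ j * p M z ^ (i - j)" by (simp flip: power_add)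
        then show "p M z ^ j * (h i z * p M z ^ (i - j)) = h i z * p M z ^ i" by simp
      qed
      also have "\<dots> = (\<Sum>i<R. h i z * p M z ^ i)"
        by (rule sum.mono_neutral_left) (auto simp: low)
      finally show ?thesis using rel[OF that] by simp
    qed
    then have "(\<forall>z\<in>Z (Suc M). p M z ^ j = 0) \<or> (\<forall>z\<in>Z (Suc M). r z = 0)"
      using integral[OF M(3) polynomial_functions_power[OF p[OF M(1)]] rp, where k1 = j] by blast
    then have "\<forall>z\<in>Z (Suc M). r z = 0" using nonzero[OF M(1)] by auto
    then have r0: "r z = 0" if "z \<in> Z M" for z using that mono[OF M(1)] by blast
    have "h j z = 0" if "z \<in> Z M" for z
    proof -
      have "r z = (\<Sum>i\<in>{j}. h i z * p M z ^ (i - j))"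
        unfolding r_def using less.prems vanish[OF M(1) that]
        by (intro sum.mono_neutral_right) (auto simp: power_0_left)
      then show ?thesis using r0[OF that] by simp
    qed
    then show ?case
      using Suc.IH[OF M(2), of "\<lambda>a. c (a(M := j))"] unfolding h_def by blast
  qed
  then show ?case
    unfolding lessThan_Suc PiE_insert_eq by auto
qed

section \<open>Krull dimension of parametrized sets\<close>

lemma topspace_zariski [simp]: "topspace (zariski V) = V"
proof
  show "topspace (zariski V) \<subseteq> V"
    using openin_topspace[of "zariski V"] unfolding openin_zariski by blast
  have "V = V - zero_locus V {\<lambda>_. 1}" by (simp add: zero_locus_def)
  moreover have "{\<lambda>_. 1} \<subseteq> polynomial_functions V" by (simp add: polynomial_functions.const)
  ultimately have "openin (zariski V) V" unfolding openin_zariski by (intro exI conjI)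
  then show "V \<subseteq> topspace (zariski V)" by (rule openin_subset)
qed

lemma closedin_zariski:
  "closedin (zariski V) C \<longleftrightarrow> (\<exists>F\<subseteq>polynomial_functions V. C = zero_locus V F)"
proof
  assume "closedin (zariski V) C"
  then obtain F where "C \<subseteq> V" "F \<subseteq> polynomial_functions V" "V - C = V - zero_locus V F"
    by (auto simp: closedin_def openin_zariski)
  moreover have "zero_locus V F \<subseteq> V" by (auto simp: zero_locus_def)
  ultimately show "\<exists>F\<subseteq>polynomial_functions V. C = zero_locus V F"
    by (metis double_diff order_refl)
next
  assume "\<exists>F\<subseteq>polynomial_functions V. C = zero_locus V F"
  then show "closedin (zariski V) C"
    by (auto simp: closedin_def openin_zariski zero_locus_def)
qed

lemma closedin_subzariski:
  assumes "S \<subseteq> V"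
  shows "closedin (subtopology (zariski V) S) C \<longleftrightarrow>
    (\<exists>F\<subseteq>polynomial_functions V. C = {v \<in> S. \<forall>p\<in>F. p v = 0})"
proof -
  have "zero_locus V F \<inter> S = {v \<in> S. \<forall>p\<in>F. p v = 0}" for F
    using assms by (auto simp: zero_locus_def)
  moreover have "closedin (subtopology (zariski V) S) C
      \<longleftrightarrow> (\<exists>F\<subseteq>polynomial_functions V. C = zero_locus V F \<inter> S)"
    unfolding closedin_subtopology closedin_zariski by blast
  ultimately show ?thesis by (simp only:)
qed

lemma irreducible_in_integral:
  fixes V :: "('b \<Rightarrow> 'a::field) set"
  assumes "S \<subseteq> V" "irreducible_in (subtopology (zariski V) S) Z"
    "f \<in> polynomial_functions V" "g \<in> polynomial_functions V" "\<forall>z\<in>Z. f z * g z = 0"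
  shows "(\<forall>z\<in>Z. f z = 0) \<or> (\<forall>z\<in>Z. g z = 0)"
proof -
  define A where "A = (\<lambda>f. {v \<in> S. f v = (0 :: 'a)})"
  have "closedin (subtopology (zariski V) S) (A h)" if "h \<in> polynomial_functions V" for h
    unfolding closedin_subzariski[OF assms(1)] A_def using that by (intro exI[of _ "{h}"]) simp
  then have "closedin (subtopology (zariski V) S) (A f)" "closedin (subtopology (zariski V) S) (A g)"
    using assms(3,4) by blast+
  moreover have "Z \<subseteq> A f \<union> A g"
    using assms(2,5) by (auto simp: irreducible_in_def A_def)
  ultimately have "Z \<subseteq> A f \<or> Z \<subseteq> A g" using assms(2) by (simp only: irreducible_in_def)
  then show ?thesis by (auto simp: A_def)
qed

lemma krull_dim_le:
  fixes \<psi> :: "(nat \<Rightarrow> 'a::field) \<Rightarrow> 'b \<Rightarrow> 'a"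
  assumes "S \<subseteq> V" "S \<subseteq> range \<psi>"
    and pull: "\<And>p. p \<in> polynomial_functions V \<Longrightarrow> (\<lambda>y. p (\<psi> y)) \<in> polyfun N"
  shows "krull_dim (subtopology (zariski V) S) \<le> enat N"
  unfolding krull_dim_def
proof (rule Sup_least, clarify)
  let ?X = "subtopology (zariski V) S"
  fix m and Z :: "nat \<Rightarrow> ('b \<Rightarrow> 'a) set"
  assume Z: "\<forall>i\<le>m. closedin ?X (Z i) \<and> irreducible_in ?X (Z i)" "\<forall>i<m. Z i \<subset> Z (Suc i)"
  have "\<exists>p. p \<in> polynomial_functions V \<and> (\<forall>z\<in>Z i. p z = 0) \<and> (\<exists>z\<in>Z (Suc i). p z \<noteq> 0)" if i: "i < m" for i
  proof -
    have "closedin ?X (Z i)" using Z(1) i by simp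
    then obtain F where F: "F \<subseteq> polynomial_functions V" "Z i = {v \<in> S. \<forall>p\<in>F. p v = 0}"
      unfolding closedin_subzariski[OF assms(1)] by (elim exE conjE)
    obtain z where z: "z \<in> Z (Suc i)" "z \<notin> Z i" using Z(2) i by blast
    have "irreducible_in ?X (Z (Suc i))" using Z(1) i by simp
    then have "z \<in> S" using z(1) by (auto simp: irreducible_in_def)
    then obtain p where "p \<in> F" "p z \<noteq> 0" using z(2) F(2) by auto
    then show ?thesis using F z(1) by blast
  qed
  then obtain p where p: "\<And>i. i < m \<Longrightarrow> p i \<in> polynomial_functions V"
    "\<And>i z. i < m \<Longrightarrow> z \<in> Z i \<Longrightarrow> p i z = 0" "\<And>i. i < m \<Longrightarrow> \<exists>z\<in>Z (Suc i). p i z \<noteq> 0"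
    by metis
  have sub: "Z m \<subseteq> S" and ne: "Z 0 \<noteq> {}" using Z(1) by (auto simp: irreducible_in_def)
  have "m \<le> N"
  proof (rule ccontr)
    assume "\<not> m \<le> N"
    then obtain R c where c: "\<exists>a\<in>{..<m} \<rightarrow>\<^sub>E {..<R}. c a \<noteq> 0"
      "\<forall>y. (\<Sum>a\<in>{..<m} \<rightarrow>\<^sub>E {..<R}. c a * (\<Prod>i<m. p i (\<psi> y) ^ a i)) = 0"
      using algebraic_relation[of m "\<lambda>i y. p i (\<psi> y)" N] pull p(1) by force
    have "\<forall>z\<in>Z m. (\<Sum>a\<in>{..<m} \<rightarrow>\<^sub>E {..<R}. c a * (\<Prod>i<m. p i z ^ a i)) = 0"
      using c(2) sub assms(2) by blast
    moreover have "Z i \<subseteq> Z (Suc i)" if "i < m" for i using Z(2) that by blast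
    moreover have "(\<forall>z\<in>Z i. f z = 0) \<or> (\<forall>z\<in>Z i. g z = 0)"
      if "i \<le> m" "f \<in> polynomial_functions V" "g \<in> polynomial_functions V" "\<forall>z\<in>Z i. f z * g z = 0"
      for i f g
      using irreducible_in_integral[OF assms(1) _ that(2-4)] Z(1) that(1) by blast
    ultimately have "\<forall>a\<in>{..<m} \<rightarrow>\<^sub>E {..<R}. c a = 0"
      using ne p
      by (intro chain_algebraically_independent[where K = m and V = V and Z = Z and p = p]) auto
    then show False using c(1) by blast
  qed
  then show "enat m \<le> enat N" by simp
qed

lemma polyfun_on_line:
  assumes "f \<in> polyfun N"
  shows "\<exists>q. \<forall>t. f (\<lambda>i. y i + t * (z i - y i)) = poly q t"
  using assms
proof induction
  case (const c)
  show ?case by (rule exI[of _ "[:c:]"]) simp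
next
  case (coord i)
  show ?case by (rule exI[of _ "[:y i, z i - y i:]"]) simp
next
  case (add f g)
  then show ?case by (metis poly_add)
next
  case (mult f g)
  then show ?case by (metis poly_mult)
qed

text \<open>
  Suppose that two closed sets cover the image and neither contains it. Choose a parameter outside
  each of them and an equation of each set that fails there. Pulled back to the line through the two
  parameters, both equations are nonzero polynomials in one variable; their finitely many zeros and
  the finitely many points outside \<open>P\<close> cannot exhaust the line.
\<close>

lemma irreducible_in_image:
  fixes \<psi> :: "(nat \<Rightarrow> 'a::field_char_0) \<Rightarrow> ('b \<Rightarrow> 'a)"
  assumes "S \<subseteq> V" "\<psi> ` P \<subseteq> S" "P \<noteq> {}"
    and pull: "\<And>p. p \<in> polynomial_functions V \<Longrightarrow> (\<lambda>y. p (\<psi> y)) \<in> polyfun N"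
    and lines: "\<And>y z. y \<in> P \<Longrightarrow> z \<in> P \<Longrightarrow> finite {t. (\<lambda>i. y i + t * (z i - y i)) \<notin> P}"
  shows "irreducible_in (subtopology (zariski V) S) (\<psi> ` P)"
  unfolding irreducible_in_def
proof (intro conjI allI impI)
  show "\<psi> ` P \<subseteq> topspace (subtopology (zariski V) S)" using assms(1,2) by auto
  show "\<psi> ` P \<noteq> {}" using assms(3) by simp
  fix A B
  assume "closedin (subtopology (zariski V) S) A \<and> closedin (subtopology (zariski V) S) B \<and> \<psi> ` P \<subseteq> A \<union> B"
  then obtain F G where F: "F \<subseteq> polynomial_functions V" "A = {v \<in> S. \<forall>p\<in>F. p v = 0}"
    and G: "G \<subseteq> polynomial_functions V" "B = {v \<in> S. \<forall>p\<in>G. p v = 0}" and cover: "\<psi> ` P \<subseteq> A \<union> B"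
    unfolding closedin_subzariski[OF assms(1)] by blast
  show "\<psi> ` P \<subseteq> A \<or> \<psi> ` P \<subseteq> B"
  proof (rule ccontr)
    assume "\<not> (\<psi> ` P \<subseteq> A \<or> \<psi> ` P \<subseteq> B)"
    then obtain y z where yz: "y \<in> P" "\<psi> y \<notin> A" "z \<in> P" "\<psi> z \<notin> B" by blast
    then obtain p q where p: "p \<in> F" "p (\<psi> y) \<noteq> 0" and q: "q \<in> G" "q (\<psi> z) \<noteq> 0"
      using F(2) G(2) assms(2) by blast
    define l where "l = (\<lambda>t i. y i + t * (z i - y i))"
    obtain p' q' where p': "\<And>t. p (\<psi> (l t)) = poly p' t" and q': "\<And>t. q (\<psi> (l t)) = poly q' t"
      using polyfun_on_line[OF pull, of p y z] polyfun_on_line[OF pull, of q y z] p(1) q(1) F(1) G(1)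
      unfolding l_def by blast
    have "l 0 = y" "l 1 = z" by (auto simp: l_def)
    then have "poly p' 0 \<noteq> 0" "poly q' 1 \<noteq> 0" using p q by (simp_all flip: p' q')
    then have "p' * q' \<noteq> 0" by auto
    then have "finite {t. poly (p' * q') t = 0}" by (rule poly_roots_finite)
    moreover have "finite {t. l t \<notin> P}" unfolding l_def by (rule lines[OF yz(1,3)])
    moreover have "UNIV \<subseteq> {t. poly (p' * q') t = 0} \<union> {t. l t \<notin> P}"
    proof
      fix t
      show "t \<in> {t. poly (p' * q') t = 0} \<union> {t. l t \<notin> P}"
      proof (cases "l t \<in> P")
        case True
        then have "\<psi> (l t) \<in> A \<union> B" using cover by blast
        then have "p (\<psi> (l t)) = 0 \<or> q (\<psi> (l t)) = 0" using F(2) G(2) p(1) q(1) by auto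
        then show ?thesis by (simp add: p' q')
      qed simp
    qed
    ultimately have "finite (UNIV :: 'a set)" using finite_subset by blast
    then show False using infinite_UNIV_char_0 by blast
  qed
qed

lemma evaluation_polynomial: "(\<lambda>v. v b) \<in> polynomial_functions V"
  by (rule polynomial_functions.linear) (simp add: linear_functional_on_def)

text \<open>
  The chain for the lower bound consists of the images of the parameter sets \<open>y 1 = \<dots> = y (N - l) = 0\<close>,
  \<open>l = N, \<dots>, 1\<close>, followed by a single point. The functions \<open>q i\<close> on the target space detect the vanishing of the
  parameters and make these images closed. The parameter \<open>y 0\<close> stays free until the last step because it
  may be subject to a condition such as \<open>y 0 \<noteq> 0\<close>.
\<close>

theorem krull_dim_parametrized:
  fixes \<psi> :: "(nat \<Rightarrow> 'a::field_char_0) \<Rightarrow> ('b \<Rightarrow> 'a)" and D :: "'a set"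
  defines "S \<equiv> \<psi> ` {y. y 0 \<in> D}"
  assumes N: "1 \<le> N" and D: "finite (- D)" "1 \<in> D" and V: "S \<subseteq> V"
    and pull: "\<And>p. p \<in> polynomial_functions V \<Longrightarrow> (\<lambda>y. p (\<psi> y)) \<in> polyfun N"
    and q: "\<And>i. 1 \<le> i \<Longrightarrow> i < N \<Longrightarrow> q i \<in> polynomial_functions V"
    and cut: "\<And>y l. y 0 \<in> D \<Longrightarrow> l < N \<Longrightarrow> (\<forall>i\<in>{1..l}. q i (\<psi> y) = 0) \<longleftrightarrow> (\<forall>i\<in>{1..l}. y i = 0)"
    and d: "d \<in> D" "\<psi> (\<lambda>i. if i = 0 then d else 0) \<noteq> \<psi> (\<lambda>i. if i = 0 then 1 else 0)"
  shows "krull_dim (subtopology (zariski V) S) = enat N"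
proof (rule antisym)
  let ?X = "subtopology (zariski V) S"
  show "krull_dim ?X \<le> enat N"
    by (rule krull_dim_le[where \<psi> = \<psi>, OF V _ pull]) (auto simp: S_def)
  define P where "P = (\<lambda>l. if l = 0 then {\<lambda>i. if i = 0 then 1 else 0}
    else {y. y 0 \<in> D \<and> (\<forall>i\<in>{1..N - l}. y i = 0)})"
  define Z where "Z = (\<lambda>l. \<psi> ` P l)"
  have ZS: "Z l \<subseteq> S" for l using D(2) by (auto simp: Z_def P_def S_def)
  have closed: "closedin ?X (Z l)" if "l \<le> N" for l
  proof (cases "l = 0")
    case True
    let ?v = "\<psi> (\<lambda>i. if i = 0 then 1 else 0)"
    let ?F = "range (\<lambda>b v. v b + (- ?v b))"
    have "?F \<subseteq> polynomial_functions V"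
      by (intro image_subsetI polynomial_functions.add evaluation_polynomial polynomial_functions.const)
    moreover have "?v \<in> S" using D(2) by (auto simp: S_def)
    then have "Z l = {v \<in> S. \<forall>p\<in>?F. p v = 0}"
      using True by (auto simp: Z_def P_def fun_eq_iff)
    ultimately show ?thesis unfolding closedin_subzariski[OF V] by blast
  next
    case False
    have l: "N - l < N" using False N by simp
    have "q ` {1..N - l} \<subseteq> polynomial_functions V" using q l by auto
    moreover have "Z l = {v \<in> S. \<forall>p\<in>q ` {1..N - l}. p v = 0}"
      using False cut[OF _ l] by (auto simp: Z_def P_def S_def)
    ultimately show ?thesis unfolding closedin_subzariski[OF V] by blast
  qed
  have irred: "irreducible_in ?X (Z l)" if "l \<le> N" for l
    unfolding Z_def
  proof (rule irreducible_in_image[OF V _ _ pull])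
    show "\<psi> ` P l \<subseteq> S" using ZS by (simp add: Z_def)
    show "P l \<noteq> {}" using D(2) by (auto simp: P_def intro!: exI[of _ "\<lambda>i. if i = 0 then 1 else 0"])
    fix y z assume yz: "y \<in> P l" "z \<in> P l"
    show "finite {t. (\<lambda>i. y i + t * (z i - y i)) \<notin> P l}"
    proof (cases "l = 0 \<or> y 0 = z 0")
      case True
      then have "(\<lambda>i. y i + t * (z i - y i)) \<in> P l" for t using yz by (auto simp: P_def)
      then show ?thesis by simp
    next
      case False
      have "{t. (\<lambda>i. y i + t * (z i - y i)) \<notin> P l} \<subseteq> (\<lambda>t. y 0 + t * (z 0 - y 0)) -` (- D)"
        using False yz by (auto simp: P_def)
      moreover have "inj (\<lambda>t. y 0 + t * (z 0 - y 0))" using False by (auto simp: inj_def)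
      ultimately show ?thesis using finite_vimageI[OF D(1)] finite_subset by blast
    qed
  qed
  have strict: "Z l \<subset> Z (Suc l)" if "l < N" for l
  proof (cases "l = 0")
    case True
    let ?y = "\<lambda>i. if i = 0 then d else (0::'a)"
    have "\<psi> ?y \<in> Z 1" "\<psi> ?y \<notin> Z 0" using d by (auto simp: Z_def P_def)
    moreover have "Z 0 \<subseteq> Z 1" using D(2) by (auto simp: Z_def P_def)
    ultimately show ?thesis using True by auto
  next
    case False
    let ?y = "\<lambda>i. if i = 0 \<or> i = N - l then 1 else (0::'a)"
    have "?y \<in> P (Suc l)" using that D(2) by (auto simp: P_def)
    then have "\<psi> ?y \<in> Z (Suc l)" by (simp add: Z_def)
    moreover have "\<psi> ?y \<notin> Z l"
    proof
      assume "\<psi> ?y \<in> Z l"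
      then obtain y where y: "y 0 \<in> D" "\<forall>i\<in>{1..N - l}. y i = 0" "\<psi> ?y = \<psi> y"
        using False by (auto simp: Z_def P_def)
      have "N - l < N" using that False by simp
      then have "\<forall>i\<in>{1..N - l}. ?y i = 0"
        using cut[of y "N - l"] cut[of ?y "N - l"] y D(2) by simp
      moreover have "N - l \<in> {1..N - l}" using that by simp
      ultimately have "?y (N - l) = 0" by blast
      then show False by simp
    qed
    moreover have "P l \<subseteq> P (Suc l)" using False by (auto simp: P_def)
    then have "Z l \<subseteq> Z (Suc l)" unfolding Z_def by (rule image_mono)
    ultimately show ?thesis by blast
  qed
  show "enat N \<le> krull_dim ?X"
    unfolding krull_dim_def using closed irred strict by (intro Sup_upper) blast
qed

section \<open>Jets of global vector fields\<close>

lemma fls_nth_poly: "fls_nth (fps_to_fls (fps_of_poly P)) i = (if i < 0 then 0 else coeff P (nat i))"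
  by simp

lemma leval_poly: "leval (fps_to_fls (fps_of_poly P)) x = poly P x"
proof -
  have "{i. fls_nth (fps_to_fls (fps_of_poly P)) i \<noteq> 0} = int ` {i. coeff P i \<noteq> 0}"
    unfolding fls_nth_poly by (force simp: image_iff intro: exI[of _ "nat _"])
  then have "leval (fps_to_fls (fps_of_poly P)) x = (\<Sum>i | coeff P i \<noteq> 0. coeff P i * x ^ i)"
    unfolding leval_def by (simp add: sum.reindex inj_on_def)
  also have "\<dots> = poly P x"
    unfolding poly_altdef by (intro sum.mono_neutral_left) (auto intro: le_degree)
  finally show ?thesis .
qed

lemma lderiv_at_poly: "lderiv_at i (fps_to_fls (fps_of_poly P)) x = poly ((pderiv ^^ i) P) x"
proof -
  have "(fls_deriv ^^ i) (fps_to_fls (fps_of_poly P)) = fps_to_fls (fps_of_poly ((pderiv ^^ i) P))"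
    by (induction i) (simp_all add: fls_deriv_fps_to_fls fps_of_poly_pderiv)
  then show ?thesis by (simp add: lderiv_at_def leval_poly)
qed

lemma taylor_poly:
  fixes P :: "'a::field_char_0 poly"
  shows "taylor x (fps_to_fls (fps_of_poly P)) = fps_of_poly (pcompose P [:x, 1:])"
proof (rule fps_ext)
  fix i
  have "(pderiv ^^ i) (pcompose P [:x, 1:]) = pcompose ((pderiv ^^ i) P) [:x, 1:]"
    by (induction i) (simp_all add: pderiv_pcompose pderiv_pCons)
  then have "poly ((pderiv ^^ i) P) x = poly ((pderiv ^^ i) (pcompose P [:x, 1:])) 0"
    by (simp add: poly_pcompose)
  also have "\<dots> = fact i * coeff (pcompose P [:x, 1:]) i"
    by (simp add: poly_0_coeff_0 coeff_higher_pderiv pochhammer_fact)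
  finally show "fps_nth (taylor x (fps_to_fls (fps_of_poly P))) i
      = fps_nth (fps_of_poly (pcompose P [:x, 1:])) i"
    by (simp add: taylor_def lderiv_at_poly)
qed

lemma fps_to_fls_poly_in_W: "fps_to_fls (fps_of_poly P) \<in> W"
proof -
  have "{i. fls_nth (fps_to_fls (fps_of_poly P)) i \<noteq> 0} \<subseteq> int ` {..degree P}"
  proof
    fix i assume "i \<in> {i. fls_nth (fps_to_fls (fps_of_poly P)) i \<noteq> 0}"
    then have "i = int (nat i)" "nat i \<le> degree P"
      unfolding fls_nth_poly by (auto intro: le_degree split: if_splits)
    then show "i \<in> int ` {..degree P}" by blast
  qed
  then show ?thesis unfolding W_def using finite_subset by blast
qed

text \<open>
  The Lie algebra enters the classification through this property: its elements have arbitrary jets at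
  \<open>x\<close>, so that the coefficients of a local functional are determined by the functional.
\<close>

definition separates_jets :: "'a::field_char_0 fls set \<Rightarrow> 'a \<Rightarrow> bool" where
  "separates_jets \<gg> x \<longleftrightarrow>
     (\<forall>n i. \<exists>f\<in>\<gg>. \<forall>j\<le>n. fps_nth (taylor x f) j = (if j = i then 1 else 0))"

text \<open>
  Since \<open>t\<^sup>2 = (u + x)\<^sup>2\<close> is invertible near \<open>x \<noteq> 0\<close>, any jet is the jet of \<open>t\<^sup>2\<close> times a polynomial in \<open>u\<close>.
\<close>

lemma separates_jets_nonzero:
  fixes x :: "'a::field_char_0"
  assumes "x \<noteq> 0" shows "separates_jets (W_ge 1) x"
  unfolding separates_jets_def
proof (intro allI)
  fix n i
  define R where "R = (fps_X ^ i * inverse ((fps_X + fps_const x)\<^sup>2) :: 'a fps)"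
  define r where "r = truncate_fps (n + 1) R"
  define P where "P = [:0, 1:]\<^sup>2 * pcompose r [:- x, 1:]"
  have "pcompose [:0, 1:] [:x, 1:] = [:x, 1:]" by (simp add: pcompose_pCons)
  moreover have "pcompose (pcompose r [:- x, 1:]) [:x, 1:] = r"
    by (simp add: pcompose_pCons flip: pcompose_assoc)
  ultimately have "pcompose P [:x, 1:] = [:x, 1:]\<^sup>2 * r"
    by (simp only: P_def pcompose_mult power2_eq_square)
  then have t: "taylor x (fps_to_fls (fps_of_poly P)) = (fps_X + fps_const x)\<^sup>2 * fps_cutoff (n + 1) R"
    by (simp add: taylor_poly fps_of_poly_mult fps_of_poly_power fps_of_poly_linear r_def)
  have "fps_nth (taylor x (fps_to_fls (fps_of_poly P))) j = (if j = i then 1 else 0)" if "j \<le> n" for j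
  proof -
    have "fps_nth (taylor x (fps_to_fls (fps_of_poly P))) j = fps_nth ((fps_X + fps_const x)\<^sup>2 * R) j"
      unfolding t fps_mult_nth using that by (intro sum.cong) auto
    also have "(fps_X + fps_const x)\<^sup>2 * R = fps_X ^ i * (inverse ((fps_X + fps_const x)\<^sup>2) * (fps_X + fps_const x)\<^sup>2)"
      by (simp only: R_def mult_ac)
    also have "inverse ((fps_X + fps_const x)\<^sup>2) * (fps_X + fps_const x)\<^sup>2 = 1"
      using assms by (intro inverse_mult_eq_1) (simp add: fps_nth_power_0)
    finally show ?thesis by simp
  qed
  moreover have "fps_to_fls (fps_of_poly P) \<in> W_ge 1"
  proof -
    have "coeff P (nat j) = 0" if "j \<le> 1" for j
    proof -
      have "nat j = 0 \<or> nat j = 1" using that by auto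
      then show ?thesis by (auto simp: P_def power2_eq_square)
    qed
    then show ?thesis
      unfolding W_ge_def using fps_to_fls_poly_in_W[of P] by (simp add: fls_nth_poly)
  qed
  ultimately show "\<exists>f\<in>W_ge 1. \<forall>j\<le>n. fps_nth (taylor x f) j = (if j = i then 1 else 0)" by blast
qed

lemma separates_jets_mono: "separates_jets \<gg> x \<Longrightarrow> \<gg> \<subseteq> \<hh> \<Longrightarrow> separates_jets \<hh> x"
  unfolding separates_jets_def by (meson subsetD)

lemma separates_jets_polynomial_fields: "separates_jets (W_ge (- 1)) (x :: 'a::field_char_0)"
  unfolding separates_jets_def
proof (intro allI)
  fix n i
  define P where "P = pcompose (monom 1 i) [:- x, 1:]"
  have "pcompose P [:x, 1:] = monom 1 i"
    by (simp add: P_def pcompose_pCons flip: pcompose_assoc)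
  then have "fps_nth (taylor x (fps_to_fls (fps_of_poly P))) j = (if j = i then 1 else 0)" for j
    by (simp add: taylor_poly)
  moreover have "fps_to_fls (fps_of_poly P) \<in> W_ge (- 1)"
    unfolding W_ge_def using fps_to_fls_poly_in_W[of P] by simp
  ultimately show "\<exists>f\<in>W_ge (- 1). \<forall>j\<le>n. fps_nth (taylor x f) j = (if j = i then 1 else 0)" by blast
qed

section \<open>Orbits in terms of coefficients\<close>

definition jet_functional :: "'a::field_char_0 fls set \<Rightarrow> 'a \<Rightarrow> nat \<Rightarrow> (nat \<Rightarrow> 'a) \<Rightarrow> ('a fls \<Rightarrow> 'a)" where
  "jet_functional \<gg> x n c = pullback \<gg> x (coeff_form n c)"

lemma fps_chi_eq_coeff_form: "fps_chi n \<beta> = coeff_form n (\<lambda>i. \<beta> i * fact i)"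
  for \<beta> :: "nat \<Rightarrow> 'a::field_char_0"
  by (simp add: fps_chi_def coeff_form_def fps_0th_higher_deriv mult_ac fun_eq_iff)

lemma fps_Loc_eq_range: "fps_Loc n = range (coeff_form n :: (nat \<Rightarrow> 'a::field_char_0) \<Rightarrow> _)"
proof -
  have "coeff_form n c = fps_chi n (\<lambda>i. c i / fact i)" for c :: "nat \<Rightarrow> 'a"
    by (simp add: fps_chi_eq_coeff_form)
  then show ?thesis
    unfolding fps_Loc_def using fps_chi_eq_coeff_form by (metis (no_types) rangeI subset_antisym image_subsetI)
qed

lemma chi_eq_jet_functional: "chi \<gg> x n \<beta> = jet_functional \<gg> x n (\<lambda>i. \<beta> i * fact i)"
  by (simp add: jet_functional_def fps_chi_eq_coeff_form flip: pullback_fps_chi)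

lemma jet_functional_cong: "(\<And>i. i \<le> n \<Longrightarrow> c i = d i) \<Longrightarrow> jet_functional \<gg> x n c = jet_functional \<gg> x n d"
  using coeff_form_eq_iff[of n c d] by (simp add: jet_functional_def)

lemma e_star_eq_jet_functional:
  assumes "j \<le> n"
  shows "e_star \<gg> x (int j - 1) = jet_functional \<gg> x n (\<lambda>i. if i = j then 1 else 0)"
proof -
  have "coeff_form n (\<lambda>i. if i = j then 1 else 0) F = fps_nth F j" for F :: "'a fps"
  proof -
    have "coeff_form n (\<lambda>i. if i = j then 1 else 0) F = (\<Sum>i\<le>n. if i = j then fps_nth F j else 0)"
      unfolding coeff_form_def by (intro sum.cong) auto
    then show ?thesis using assms by simp
  qed
  then show ?thesis
    by (simp add: jet_functional_def pullback_def e_star_def taylor_def fun_eq_iff)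
qed

lemma jet_functional_add: 
  "jet_functional \<gg> x n c f + jet_functional \<gg> x n d f = jet_functional \<gg> x n (\<lambda>i. c i + d i) f"
  by (simp add: jet_functional_def pullback_def coeff_form_def sum.distrib algebra_simps)

lemma jet_functional_scale: 
  "r * jet_functional \<gg> x n c f = jet_functional \<gg> x n (\<lambda>i. r * c i) f"
  by (simp add: jet_functional_def pullback_def coeff_form_def sum_distrib_left algebra_simps)

lemma jet_functional_coordinate:
  assumes "separates_jets \<gg> x" "i \<le> n"
  shows "\<exists>f. \<forall>c. jet_functional \<gg> x n c f = c i"
proof -
  obtain f where f: "f \<in> \<gg>" "\<forall>j\<le>n. fps_nth (taylor x f) j = (if j = i then 1 else 0)"
    using assms(1) unfolding separates_jets_def by blast
  have "jet_functional \<gg> x n c f = c i" for c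
  proof -
    have "coeff_form n c (taylor x f) = (\<Sum>j\<le>n. if j = i then c i else 0)"
      unfolding coeff_form_def using f(2) by (intro sum.cong) auto
    then show ?thesis using assms(2) f(1) by (simp add: jet_functional_def pullback_def)
  qed
  then show ?thesis by blast
qed

lemma jet_functional_eq_iff:
  assumes "separates_jets \<gg> x"
  shows "jet_functional \<gg> x n c = jet_functional \<gg> x n d \<longleftrightarrow> (\<forall>i\<le>n. c i = d i)"
  using jet_functional_coordinate[OF assms] jet_functional_cong by metis

lemma Loc_eq_range: "Loc \<gg> x n = range (jet_functional \<gg> x n)"
  by (auto simp: Loc_eq_pullback fps_Loc_eq_range jet_functional_def image_iff)

lemma End_subst_eq: "End_subst x s = vf_subst (s - fps_const x)"
  by (simp add: End_subst_def vf_subst_def fun_eq_iff)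

lemma DLoc_eq: "DLoc x = vf_subst ` {\<sigma>. uniformizer \<sigma>}"
proof
  show "DLoc x \<subseteq> vf_subst ` {\<sigma>. uniformizer \<sigma>}"
    by (auto simp: DLoc_def End_subst_eq uniformizer_def)
  show "vf_subst ` {\<sigma>. uniformizer \<sigma>} \<subseteq> DLoc x"
  proof clarify
    fix \<sigma> :: "'a fps" assume "uniformizer \<sigma>"
    then have "vf_subst \<sigma> = End_subst x (\<sigma> + fps_const x)" "fps_nth (\<sigma> + fps_const x) 0 = x"
      "fps_nth (\<sigma> + fps_const x) 1 \<noteq> 0"
      by (auto simp: End_subst_eq uniformizer_def)
    then show "vf_subst \<sigma> \<in> DLoc x" unfolding DLoc_def by blast
  qed
qed

lemma inv_vf_subst: "uniformizer \<sigma> \<Longrightarrow> inv (vf_subst \<sigma>) = vf_subst (fps_inv \<sigma>)"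
  by (rule inv_equality) (simp_all add: vf_subst_inv)

lemma dual_act_DLoc: "(\<lambda>g. dual_act g \<phi>) ` DLoc x = (\<lambda>\<sigma>. \<phi> \<circ> vf_subst \<sigma>) ` {\<sigma>. uniformizer \<sigma>}"
proof -
  have "(\<lambda>g. dual_act g \<phi>) ` DLoc x = (\<lambda>\<sigma>. \<phi> \<circ> vf_subst (fps_inv \<sigma>)) ` {\<sigma>. uniformizer \<sigma>}"
    unfolding DLoc_eq image_image by (intro image_cong) (auto simp: dual_act_def inv_vf_subst)
  also have "\<dots> = (\<lambda>\<sigma>. \<phi> \<circ> vf_subst \<sigma>) ` {\<sigma>. uniformizer \<sigma>}"
  proof -
    have "fps_inv ` {\<sigma>. uniformizer \<sigma>} = {\<sigma> :: 'a fps. uniformizer \<sigma>}"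
      using uniformizer_inv fps_inv_idempotent unfolding uniformizer_def
      by (force simp: image_iff)
    moreover have "(\<lambda>\<sigma>. \<phi> \<circ> vf_subst (fps_inv \<sigma>)) ` {\<sigma>. uniformizer \<sigma>}
        = (\<lambda>\<sigma>. \<phi> \<circ> vf_subst \<sigma>) ` fps_inv ` {\<sigma>. uniformizer \<sigma>}"
      by (simp only: image_image)
    ultimately show ?thesis by (simp only:)
  qed
  finally show ?thesis .
qed

text \<open>
  Since the action does not raise the order, the orbit of a functional of order \<open>n\<close> is the same in every
  space of functionals of order at most \<open>m \<ge> n\<close>.
\<close>

lemma orbit_jet_functional:
  assumes "separates_jets \<gg> x" "n \<le> m"
  shows "orbit \<gg> x m (jet_functional \<gg> x n c) = {jet_functional \<gg> x n d | d. equiv_form n c d}"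
proof -
  have extend: "coeff_form n d = coeff_form m (\<lambda>i. if i \<le> n then d i else 0)" for d :: "nat \<Rightarrow> 'a"
    unfolding coeff_form_def fun_eq_iff using assms(2)
    by (intro allI sum.mono_neutral_cong_left) auto
  have mem: "coeff_form n d \<in> fps_Loc m" for d :: "nat \<Rightarrow> 'a"
    unfolding fps_Loc_eq_range extend by (rule rangeI)
  have inj: "\<phi> = coeff_form n c"
    if \<phi>: "\<phi> \<in> fps_Loc m" "pullback \<gg> x \<phi> = jet_functional \<gg> x n c" for \<phi>
  proof -
    obtain d where d: "\<phi> = coeff_form m d" using \<phi>(1) unfolding fps_Loc_eq_range by blast
    let ?c = "\<lambda>i. if i \<le> n then c i else 0"
    have "jet_functional \<gg> x m d = jet_functional \<gg> x m ?c"
      using \<phi>(2) unfolding jet_functional_def d extend[of c] .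
    then have "coeff_form m d = coeff_form m ?c"
      by (simp only: jet_functional_eq_iff[OF assms(1)] coeff_form_eq_iff)
    then show ?thesis unfolding d extend[of c] .
  qed
  have "orbit \<gg> x m (jet_functional \<gg> x n c) = pullback \<gg> x ` (\<lambda>g. dual_act g (coeff_form n c)) ` DLoc x"
    (is "?L = ?R")
  proof
    show "?L \<subseteq> ?R"
    proof
      fix \<nu> assume "\<nu> \<in> ?L"
      then obtain A \<phi> where *: "\<nu> = pullback \<gg> x (A \<phi>)" "A \<in> DLoc_le x m" "\<phi> \<in> fps_Loc m"
        "pullback \<gg> x \<phi> = jet_functional \<gg> x n c" unfolding orbit_def by blast
      then show "\<nu> \<in> ?R" using inj[OF *(3,4)] by (auto simp: DLoc_le_def)
    qed
    show "?R \<subseteq> ?L"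
    proof
      fix \<nu> assume "\<nu> \<in> ?R"
      then obtain g where g: "g \<in> DLoc x" "\<nu> = pullback \<gg> x (dual_act g (coeff_form n c))" by blast
      let ?A = "restrict (dual_act g) (fps_Loc m)"
      have "?A \<in> DLoc_le x m" using g(1) by (auto simp: DLoc_le_def)
      moreover have "\<nu> = pullback \<gg> x (?A (coeff_form n c))" using g(2) mem by simp
      ultimately show "\<nu> \<in> ?L"
        unfolding orbit_def jet_functional_def using mem[of c] by blast
    qed
  qed
  moreover have "(\<lambda>\<sigma>. coeff_form n c \<circ> vf_subst \<sigma>) ` {\<sigma>. uniformizer \<sigma>} = {coeff_form n d | d. equiv_form n c d}"
  proof
    show "(\<lambda>\<sigma>. coeff_form n c \<circ> vf_subst \<sigma>) ` {\<sigma>. uniformizer \<sigma>} \<subseteq> {coeff_form n d | d. equiv_form n c d}"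
    proof clarify
      fix \<sigma> :: "'a fps" assume u: "uniformizer \<sigma>"
      note equiv_formI[OF u, of n c]
      moreover have "coeff_form n c \<circ> vf_subst \<sigma> = coeff_form n (\<lambda>i. coeff_form n c (vf_subst \<sigma> (fps_X ^ i)))"
        unfolding o_def by (rule ext) (rule coeff_form_vf_subst[OF u])
      ultimately show "\<exists>d. coeff_form n c \<circ> vf_subst \<sigma> = coeff_form n d \<and> equiv_form n c d"
        by (intro exI[of _ "\<lambda>i. coeff_form n c (vf_subst \<sigma> (fps_X ^ i))"] conjI)
    qed
    show "{coeff_form n d | d. equiv_form n c d} \<subseteq> (\<lambda>\<sigma>. coeff_form n c \<circ> vf_subst \<sigma>) ` {\<sigma>. uniformizer \<sigma>}"
    proof clarify
      fix d assume "equiv_form n c d"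
      then obtain \<sigma> where "uniformizer \<sigma>" "\<forall>f. coeff_form n c (vf_subst \<sigma> f) = coeff_form n d f"
        unfolding equiv_form_def by blast
      then show "coeff_form n d \<in> (\<lambda>\<sigma>. coeff_form n c \<circ> vf_subst \<sigma>) ` {\<sigma>. uniformizer \<sigma>}"
        by (intro image_eqI[of _ _ \<sigma>]) (simp_all add: fun_eq_iff)
    qed
  qed
  ultimately have "orbit \<gg> x m (jet_functional \<gg> x n c) = pullback \<gg> x ` {coeff_form n d | d. equiv_form n c d}"
    by (simp only: dual_act_DLoc)
  also have "\<dots> = {jet_functional \<gg> x n d | d. equiv_form n c d}"
    unfolding jet_functional_def by blast
  finally show ?thesis .
qed

lemma orbit_eq_iff:
  assumes "separates_jets \<gg> x" "n \<le> m"
  shows "orbit \<gg> x m (jet_functional \<gg> x n c) = orbit \<gg> x m (jet_functional \<gg> x n d) \<longleftrightarrow> equiv_form n c d"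
proof
  assume "orbit \<gg> x m (jet_functional \<gg> x n c) = orbit \<gg> x m (jet_functional \<gg> x n d)"
  then have "jet_functional \<gg> x n d \<in> {jet_functional \<gg> x n e | e. equiv_form n c e}"
    unfolding orbit_jet_functional[OF assms] using equiv_form_refl by blast
  then obtain e where "jet_functional \<gg> x n d = jet_functional \<gg> x n e" "equiv_form n c e" by blast
  then show "equiv_form n c d"
    using equiv_form_cong[of n c e d] jet_functional_eq_iff[OF assms(1)] by simp
next
  assume "equiv_form n c d"
  then have "equiv_form n c e \<longleftrightarrow> equiv_form n d e" for e
    using equiv_form_trans equiv_form_sym by blast
  then show "orbit \<gg> x m (jet_functional \<gg> x n c) = orbit \<gg> x m (jet_functional \<gg> x n d)"
    unfolding orbit_jet_functional[OF assms] by simp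
qed

section \<open>Dimensions of the orbits and the classification\<close>

lemma polyfun_sum:
  assumes "\<And>i. i \<in> A \<Longrightarrow> f i \<in> polyfun N"
  shows "(\<lambda>y. \<Sum>i\<in>A. f i y) \<in> polyfun N"
  using assms by (induction A rule: infinite_finite_induct) (auto intro: polyfun.intros)

text \<open>
  Every linear functional on the space of local functionals is a linear combination of the
  coefficients, so polynomial functions on it pull back to polynomials in the parameters.
\<close>

lemma polynomial_function_jet_functional:
  fixes C :: "(nat \<Rightarrow> 'a::field_char_0) \<Rightarrow> nat \<Rightarrow> 'a"
  assumes C: "\<And>i. i \<le> n \<Longrightarrow> (\<lambda>y. C y i) \<in> polyfun N"
    and p: "p \<in> polynomial_functions (Loc \<gg> x n)"
  shows "(\<lambda>y. p (jet_functional \<gg> x n (C y))) \<in> polyfun N"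
  using p
proof induction
  case (linear l)
  let ?J = "jet_functional \<gg> x n"
  have "?J c \<in> Loc \<gg> x n" for c unfolding Loc_eq_range by (rule rangeI)
  then have add: "l (\<lambda>f. ?J c f + ?J d f) = l (?J c) + l (?J d)"
    and scale: "l (\<lambda>f. r * ?J c f) = r * l (?J c)" for c d r
    using linear unfolding linear_functional_on_def by blast+
  define e where "e = (\<lambda>j i :: nat. if i = j then 1 else (0::'a))"
  have expand: "l (?J (\<lambda>i. if i < m then c i else 0)) = (\<Sum>i<m. c i * l (?J (e i)))" for m c
  proof (induction m)
    case 0
    have "?J (\<lambda>i. 0) = (\<lambda>f. 0 * ?J (\<lambda>i. 0) f)" by (simp only: jet_functional_scale) simp
    then show ?case using scale[of 0 "\<lambda>i. 0"] by simp
  next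
    case (Suc m)
    let ?A = "?J (\<lambda>i. if i < m then c i else 0)" and ?B = "?J (\<lambda>i. c m * e m i)"
    have "?J (\<lambda>i. if i < Suc m then c i else 0)
        = (\<lambda>f. ?A f + ?B f)"
      unfolding jet_functional_add by (intro ext fun_cong[OF jet_functional_cong]) (auto simp: e_def less_Suc_eq)
    then have "l (?J (\<lambda>i. if i < Suc m then c i else 0)) = l ?A + l ?B" by (simp only: add)
    also have "?B = (\<lambda>f. c m * ?J (e m) f)" by (simp only: jet_functional_scale)
    also have "l (\<lambda>f. c m * ?J (e m) f) = c m * l (?J (e m))" by (rule scale)
    finally show ?case by (simp add: Suc)
  qed
  have "l (?J c) = (\<Sum>i<Suc n. c i * l (?J (e i)))" for c
    unfolding expand[symmetric] by (rule arg_cong[where f = l], rule jet_functional_cong) simp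
  then have eq: "(\<lambda>y. l (?J (C y))) = (\<lambda>y. \<Sum>i<Suc n. C y i * l (?J (e i)))" by (rule ext)
  show ?case
    unfolding eq by (intro polyfun_sum polyfun.mult polyfun.const C) simp
qed (auto intro: polyfun.intros)

lemma orbit_dim_parametrized:
  fixes C :: "(nat \<Rightarrow> 'a::field_char_0) \<Rightarrow> nat \<Rightarrow> 'a"
  assumes sep: "separates_jets \<gg> x" and N: "1 \<le> N" and D: "finite (- D)" "1 \<in> D"
    and C: "\<And>i. i \<le> n \<Longrightarrow> (\<lambda>y. C y i) \<in> polyfun N"
    and param: "\<And>c'. equiv_form n c c' \<longleftrightarrow> (\<exists>y. y 0 \<in> D \<and> (\<forall>i\<le>n. c' i = C y i))"
    and r: "\<And>i. 1 \<le> i \<Longrightarrow> i < N \<Longrightarrow> r i \<le> n"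
    and cut: "\<And>y l. y 0 \<in> D \<Longrightarrow> l < N \<Longrightarrow> (\<forall>i\<in>{1..l}. C y (r i) = 0) \<longleftrightarrow> (\<forall>i\<in>{1..l}. y i = 0)"
    and d: "d \<in> D" "j \<le> n" "C (\<lambda>i. if i = 0 then d else 0) j \<noteq> C (\<lambda>i. if i = 0 then 1 else 0) j"
  shows "orbit_dim \<gg> x n (jet_functional \<gg> x n c) = enat N"
proof -
  define \<psi> where "\<psi> = (\<lambda>y. jet_functional \<gg> x n (C y))"
  have orbit: "orbit \<gg> x n (jet_functional \<gg> x n c) = \<psi> ` {y. y 0 \<in> D}"
  proof -
    have "{jet_functional \<gg> x n c' | c'. equiv_form n c c'} = \<psi> ` {y. y 0 \<in> D}"
    proof
      show "{jet_functional \<gg> x n c' | c'. equiv_form n c c'} \<subseteq> \<psi> ` {y. y 0 \<in> D}"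
      proof clarify
        fix c' assume "equiv_form n c c'"
        then obtain y where "y 0 \<in> D" "\<forall>i\<le>n. c' i = C y i" using param by blast
        then show "jet_functional \<gg> x n c' \<in> \<psi> ` {y. y 0 \<in> D}"
          by (intro image_eqI[of _ _ y]) (auto simp: \<psi>_def intro: jet_functional_cong)
      qed
      show "\<psi> ` {y. y 0 \<in> D} \<subseteq> {jet_functional \<gg> x n c' | c'. equiv_form n c c'}"
        unfolding \<psi>_def using param by blast
    qed
    then show ?thesis by (simp only: orbit_jet_functional[OF sep order_refl])
  qed
  have "\<forall>i. \<exists>f. i \<le> n \<longrightarrow> (\<forall>c. jet_functional \<gg> x n c f = c i)"
    using jet_functional_coordinate[OF sep] by blast
  then obtain f where f: "\<And>i c. i \<le> n \<Longrightarrow> jet_functional \<gg> x n c (f i) = c i" by metis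
  show ?thesis
    unfolding orbit_dim_def orbit
  proof (rule krull_dim_parametrized[where q = "\<lambda>i v. v (f (r i))" and d = d])
    show "\<psi> ` {y. y 0 \<in> D} \<subseteq> Loc \<gg> x n" unfolding Loc_eq_range \<psi>_def by blast
    show "(\<lambda>y. p (\<psi> y)) \<in> polyfun N" if "p \<in> polynomial_functions (Loc \<gg> x n)" for p
      unfolding \<psi>_def using C that by (rule polynomial_function_jet_functional)
    show "(\<lambda>v. v (f (r i))) \<in> polynomial_functions (Loc \<gg> x n)" for i
      by (rule evaluation_polynomial)
    show "(\<forall>i\<in>{1..l}. \<psi> y (f (r i)) = 0) \<longleftrightarrow> (\<forall>i\<in>{1..l}. y i = 0)" if "y 0 \<in> D" "l < N" for y l
    proof -
      have "\<psi> y (f (r i)) = C y (r i)" if "i \<in> {1..l}" for i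
        unfolding \<psi>_def using f r that \<open>l < N\<close> by simp
      then show ?thesis using cut[of y l, OF that] by simp
    qed
    show "\<psi> (\<lambda>i. if i = 0 then d else 0) \<noteq> \<psi> (\<lambda>i. if i = 0 then 1 else 0)"
      unfolding \<psi>_def jet_functional_eq_iff[OF sep] using d(2,3) by blast
  qed (use N D d in auto)
qed

text \<open>
  The orbit is the open set \<open>c n \<noteq> 0\<close>. The parameters are the coefficients listed from the top, so that
  the condition falls on \<open>y 0\<close>.
\<close>

lemma orbit_dim_even:
  fixes c :: "nat \<Rightarrow> 'a::{alg_closed_field,field_char_0}"
  assumes "separates_jets \<gg> x" "even n" "c n \<noteq> 0"
  shows "orbit_dim \<gg> x n (jet_functional \<gg> x n c) = enat (n + 1)"
proof (rule orbit_dim_parametrized[where C = "\<lambda>y i. y (n - i)" and r = "\<lambda>i. n - i" and D = "- {0}" and d = 2 and j = n])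
  show "equiv_form n c c' \<longleftrightarrow> (\<exists>y. y 0 \<in> - {0} \<and> (\<forall>i\<le>n. c' i = y (n - i)))" for c'
  proof -
    have "equiv_form n c c' \<longleftrightarrow> c' n \<noteq> 0"
    proof
      assume "c' n \<noteq> 0"
      then show "equiv_form n c c'"
        using equiv_form_trans[OF equiv_normal_form_even equiv_form_sym[OF equiv_normal_form_even]] assms by blast
    qed (use equiv_form_top_nonzero assms(3) in blast)
    also have "\<dots> \<longleftrightarrow> (\<exists>y. y 0 \<in> - {0} \<and> (\<forall>i\<le>n. c' i = y (n - i)))"
    proof
      assume "c' n \<noteq> 0"
      then show "\<exists>y. y 0 \<in> - {0} \<and> (\<forall>i\<le>n. c' i = y (n - i))"
        by (intro exI[of _ "\<lambda>i. c' (n - i)"]) auto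
    qed auto
    finally show ?thesis .
  qed
  show "(\<lambda>y. y (n - i)) \<in> polyfun (n + 1)" for i by (rule polyfun.coord) simp
  show "(\<forall>i\<in>{1..l}. y (n - (n - i)) = 0) \<longleftrightarrow> (\<forall>i\<in>{1..l}. y i = 0)" if "l < n + 1" for y :: "nat \<Rightarrow> 'a" and l
    using that by auto
qed (use assms in auto)

lemma orbit_dim_one:
  fixes c :: "nat \<Rightarrow> 'a::field_char_0"
  assumes "separates_jets \<gg> x" "c 1 \<noteq> 0"
  shows "orbit_dim \<gg> x 1 (jet_functional \<gg> x 1 c) = enat 1"
proof (rule orbit_dim_parametrized[where C = "\<lambda>y i. if i = 0 then y 0 else c 1" and r = id and D = UNIV and d = 2 and j = 0])
  show "equiv_form 1 c c' \<longleftrightarrow> (\<exists>y. y 0 \<in> UNIV \<and> (\<forall>i\<le>1. c' i = (if i = 0 then y 0 else c 1)))" for c'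
    unfolding equiv_form_one[of c, OF assms(2)] by (auto simp: le_Suc_eq intro: exI[of _ c'])
  show "(\<lambda>y. if i = 0 then y 0 else c 1) \<in> polyfun 1" for i
    by (cases "i = 0") (auto intro: polyfun.intros)
qed (use assms in auto)

text \<open>
  The parameters \<open>y 0, \<dots>, y (k - 1)\<close> are the coefficients of the square root before its residue, and
  \<open>y k, \<dots>, y (2 * k)\<close> are the coefficients \<open>c 0, \<dots>, c k\<close>. Once \<open>y 1, \<dots>, y (i - 1)\<close> vanish, the coefficient
  of index \<open>n - i\<close> is \<open>2 * y 0 * y i\<close>, so it detects the vanishing of \<open>y i\<close>.
\<close>

lemma orbit_dim_odd:
  fixes \<beta> :: "'a::{alg_closed_field,field_char_0}"
  assumes "separates_jets \<gg> x" "k \<ge> 1"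
    and c: "equiv_form (2 * k + 1) c (normal_form (2 * k + 1) (2 * \<beta>))"
  shows "orbit_dim \<gg> x (2 * k + 1) (jet_functional \<gg> x (2 * k + 1) c) = enat (2 * k + 1)"
proof -
  define n where "n = 2 * k + 1"
  define b where "b = (\<lambda>y j. if j = k then \<beta> else y j)"
  define C where "C = (\<lambda>y i. if i \<le> k then y (k + i) else \<Sum>j\<le>n - i. b y j * b y (n - i - j))"
  define r where "r = (\<lambda>i. if i < k then n - i else i - k)"
  have leading: "C y (n - i) = 2 * y 0 * y i" if "1 \<le> i" "i < k" "\<forall>j\<in>{1..<i}. y j = 0" for y i
  proof -
    have "C y (n - i) = (\<Sum>j\<le>i. b y j * b y (i - j))" using that by (simp add: C_def n_def)
    also have "\<dots> = 2 * b y 0 * b y i + (\<Sum>j\<in>{1..<i}. b y j * b y (i - j))"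
      using that by (intro convolution_split) simp
    also have "(\<Sum>j\<in>{1..<i}. b y j * b y (i - j)) = 0"
      using that by (intro sum.neutral) (auto simp: b_def)
    finally show ?thesis using that by (simp add: b_def)
  qed
  show ?thesis
    unfolding n_def[symmetric]
  proof (rule orbit_dim_parametrized[where C = C and r = r and D = "- {0}" and d = 2 and j = n])
    have "equiv_form n c c' \<longleftrightarrow> equiv_form n (normal_form n (2 * \<beta>)) c'" for c'
      using c equiv_form_trans equiv_form_sym unfolding n_def by blast
    also have "\<dots> c' \<longleftrightarrow> square_root_residue k \<beta> c'" for c'
      unfolding n_def by (rule equiv_normal_form_iff_residue[OF assms(2)])
    also have "\<dots> c' \<longleftrightarrow> (\<exists>y. y 0 \<in> - {0} \<and> (\<forall>i\<le>n. c' i = C y i))" for c'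
    proof
      assume "square_root_residue k \<beta> c'"
      then obtain a where a: "a 0 \<noteq> 0" "a k = \<beta>" "\<forall>l\<le>k. c' (n - l) = (\<Sum>i\<le>l. a i * a (l - i))"
        unfolding square_root_residue_def n_def by blast
      define y where "y = (\<lambda>j. if j < k then a j else c' (j - k))"
      have by': "b y j = a j" if "j \<le> k" for j using that a(2) by (simp add: b_def y_def)
      have "c' i = C y i" if "i \<le> n" for i
      proof (cases "i \<le> k")
        case False
        then have "n - i \<le> k" by (simp add: n_def)
        then have "c' (n - (n - i)) = (\<Sum>j\<le>n - i. b y j * b y (n - i - j))"
          using a(3) by (simp add: by')
        then show ?thesis using False that by (simp add: C_def)
      qed (simp add: C_def y_def)
      moreover have "y 0 \<in> - {0}" using a(1) assms(2) by (simp add: y_def)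
      ultimately show "\<exists>y. y 0 \<in> - {0} \<and> (\<forall>i\<le>n. c' i = C y i)" by blast
    next
      assume "\<exists>y. y 0 \<in> - {0} \<and> (\<forall>i\<le>n. c' i = C y i)"
      then obtain y where y: "y 0 \<noteq> 0" "\<forall>i\<le>n. c' i = C y i" by auto
      have "c' (n - l) = (\<Sum>i\<le>l. b y i * b y (l - i))" if "l \<le> k" for l
      proof -
        have "\<not> n - l \<le> k" "n - (n - l) = l" using that by (auto simp: n_def)
        then show ?thesis using y(2) by (simp add: C_def)
      qed
      moreover have "b y 0 \<noteq> 0" "b y k = \<beta>" using y(1) assms(2) by (auto simp: b_def)
      ultimately show "square_root_residue k \<beta> c'"
        unfolding square_root_residue_def n_def by blast
    qed
    finally show "equiv_form n c c' \<longleftrightarrow> (\<exists>y. y 0 \<in> - {0} \<and> (\<forall>i\<le>n. c' i = C y i))" for c' .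
    show "(\<lambda>y. C y i) \<in> polyfun n" if "i \<le> n" for i
    proof (cases "i \<le> k")
      case True
      then show ?thesis unfolding C_def by (simp add: polyfun.coord n_def)
    next
      case False
      have "(\<lambda>y. b y j) \<in> polyfun n" if "j \<le> k" for j
        using that unfolding b_def by (cases "j = k") (auto intro: polyfun.intros simp: n_def)
      moreover have "n - i \<le> k" using False by (simp add: n_def)
      ultimately show ?thesis
        using False unfolding C_def by (auto intro!: polyfun_sum polyfun.mult)
    qed
    show "r i \<le> n" if "i < n" for i using that by (auto simp: r_def n_def)
    show "(\<forall>i\<in>{1..l}. C y (r i) = 0) \<longleftrightarrow> (\<forall>i\<in>{1..l}. y i = 0)" if y: "y 0 \<in> - {0}" and "l < n" for y l
      using \<open>l < n\<close>
    proof (induction l)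
      case (Suc l)
      have "C y (r (Suc l)) = 0 \<longleftrightarrow> y (Suc l) = 0" if "\<forall>i\<in>{1..l}. y i = 0"
      proof (cases "Suc l < k")
        case True
        have "\<forall>j\<in>{1..<Suc l}. y j = 0" using that by auto
        then have "C y (n - Suc l) = 2 * y 0 * y (Suc l)" using True by (intro leading) auto
        then show ?thesis using y True by (simp add: r_def)
      next
        case False
        then show ?thesis using Suc.prems by (simp add: r_def C_def n_def)
      qed
      then show ?case using Suc by (auto simp: atLeastAtMostSuc_conv)
    qed simp
    have "C (\<lambda>i. if i = 0 then z else 0) n = z * z" for z
      using assms(2) by (simp add: C_def b_def n_def)
    then show "C (\<lambda>i. if i = 0 then 2 else 0) n \<noteq> C (\<lambda>i. if i = 0 then 1 else 0) n" by simp
  qed (use assms in \<open>auto simp: n_def\<close>)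
qed

lemma normal_form_eq_jet_functional:
  fixes b :: "'a::field_char_0"
  assumes "k \<ge> 1"
  shows "(\<lambda>f. e_star \<gg> x (int (2 * k)) f + b * e_star \<gg> x (int k) f)
    = jet_functional \<gg> x (2 * k + 1) (normal_form (2 * k + 1) b)"
proof -
  have "e_star \<gg> x (int (2 * k)) = jet_functional \<gg> x (2 * k + 1) (\<lambda>i. if i = 2 * k + 1 then 1 else 0)"
    using e_star_eq_jet_functional[of "2 * k + 1" "2 * k + 1" \<gg> x] by simp
  moreover have "e_star \<gg> x (int k) = jet_functional \<gg> x (2 * k + 1) (\<lambda>i. if i = k + 1 then 1 else 0)"
    using e_star_eq_jet_functional[of "k + 1" "2 * k + 1" \<gg> x] by simp
  ultimately show ?thesis
    using assms
    by (simp only: jet_functional_scale jet_functional_add)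
      (intro ext fun_cong[OF jet_functional_cong], auto simp: normal_form_def)
qed

theorem theorem4p2p1:
  fixes \<gg> :: "'a::{alg_closed_field,field_char_0} fls set"
    and x :: 'a and n :: nat and \<beta> :: "nat \<Rightarrow> 'a"
  assumes "uncountable (UNIV :: 'a set)"
    and "\<gg> = W_ge (-1) \<or> \<gg> = W \<or> \<gg> = W_ge 1"
    and "\<gg> = W \<or> \<gg> = W_ge 1 \<Longrightarrow> x \<noteq> 0"
    and "\<beta> n \<noteq> 0"
  shows
    "(even n \<longrightarrow>
        orbit \<gg> x n (chi \<gg> x n \<beta>) = orbit \<gg> x n (e_star \<gg> x (int n - 1)) \<and>
        orbit_dim \<gg> x n (chi \<gg> x n \<beta>) = enat (n + 1)) \<and>
     (odd n \<and> n > 1 \<longrightarrow>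
        (\<exists>b. orbit \<gg> x n (chi \<gg> x n \<beta>) =
             orbit \<gg> x n (\<lambda>f. e_star \<gg> x (int n - 1) f + b * e_star \<gg> x (int ((n - 1) div 2)) f)) \<and>
        orbit_dim \<gg> x n (chi \<gg> x n \<beta>) = enat n) \<and>
     (n = 1 \<longrightarrow>
        orbit \<gg> x n (chi \<gg> x n \<beta>) = orbit \<gg> x n (\<lambda>f. \<beta> 1 * e_star \<gg> x 0 f) \<and>
        orbit_dim \<gg> x n (chi \<gg> x n \<beta>) = 1) \<and>
     (\<forall>(b1::'a) b2 (k::nat) (m::nat). k \<ge> 1 \<and> m \<ge> 2 * k + 1 \<longrightarrow>
        (orbit \<gg> x m (\<lambda>f. e_star \<gg> x (int (2 * k)) f + b1 * e_star \<gg> x (int k) f) =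
           orbit \<gg> x m (\<lambda>f. e_star \<gg> x (int (2 * k)) f + b2 * e_star \<gg> x (int k) f)
         \<longleftrightarrow> b1 = b2 \<or> b1 = - b2)) \<and>
     (\<forall>b1 b2 :: 'a.
        orbit \<gg> x 1 (\<lambda>f. b1 * e_star \<gg> x 0 f) = orbit \<gg> x 1 (\<lambda>f. b2 * e_star \<gg> x 0 f)
          \<longleftrightarrow> b1 = b2)"
proof -
  have "separates_jets \<gg> x"
  proof (cases "\<gg> = W_ge (- 1)")
    case False
    then have "W_ge 1 \<subseteq> \<gg>" "x \<noteq> 0" using assms(2,3) by (auto simp: W_ge_def)
    then show ?thesis using separates_jets_mono[OF separates_jets_nonzero] by blast
  qed (simp add: separates_jets_polynomial_fields)
  note sep = this
  define c where "c = (\<lambda>i. \<beta> i * fact i)"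
  have chi: "chi \<gg> x n \<beta> = jet_functional \<gg> x n c" unfolding c_def by (rule chi_eq_jet_functional)
  have c0: "c n \<noteq> 0" using assms(4) by (simp add: c_def)
  have first: "(\<lambda>f. b * e_star \<gg> x 0 f) = jet_functional \<gg> x 1 (\<lambda>i. if i = 1 then b else 0)" for b
    using e_star_eq_jet_functional[of 1 1 \<gg> x]
    by (simp add: jet_functional_scale if_distrib cong: if_cong)
  show ?thesis
  proof (intro conjI impI allI)
    assume "even n"
    have "e_star \<gg> x (int n - 1) = jet_functional \<gg> x n (normal_form n 0)"
      by (simp add: e_star_eq_jet_functional[of n n] normal_form_def if_distrib cong: if_cong)
    then show "orbit \<gg> x n (chi \<gg> x n \<beta>) = orbit \<gg> x n (e_star \<gg> x (int n - 1))"
      unfolding chi by (simp only: orbit_eq_iff[OF sep order_refl] equiv_normal_form_even[of c n, OF c0 \<open>even n\<close>])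
    show "orbit_dim \<gg> x n (chi \<gg> x n \<beta>) = enat (n + 1)"
      unfolding chi by (rule orbit_dim_even[of \<gg> x n c, OF sep \<open>even n\<close> c0])
  next
    assume odd: "odd n \<and> n > 1"
    define k where "k = (n - 1) div 2"
    have k: "k \<ge> 1" "n = 2 * k + 1" "int n - 1 = int (2 * k)" using odd by (auto simp: k_def elim: oddE)
    obtain b where b: "equiv_form n c (normal_form n b)"
      using equiv_normal_form[of c n] c0 odd by auto
    have "orbit \<gg> x n (chi \<gg> x n \<beta>) = orbit \<gg> x n (\<lambda>f. e_star \<gg> x (int n - 1) f + b * e_star \<gg> x (int k) f)"
      unfolding chi k(3) normal_form_eq_jet_functional[OF k(1)] k(2)[symmetric]
      using b by (simp only: orbit_eq_iff[OF sep order_refl])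
    then show "\<exists>b. orbit \<gg> x n (chi \<gg> x n \<beta>) =
        orbit \<gg> x n (\<lambda>f. e_star \<gg> x (int n - 1) f + b * e_star \<gg> x (int ((n - 1) div 2)) f)"
      unfolding k_def by blast
    have "equiv_form (2 * k + 1) c (normal_form (2 * k + 1) (2 * (b / 2)))" using b k(2) by simp
    from orbit_dim_odd[OF sep k(1) this]
    show "orbit_dim \<gg> x n (chi \<gg> x n \<beta>) = enat n" unfolding chi k(2)[symmetric] .
  next
    assume "n = 1"
    then have c1: "c 1 \<noteq> 0" "c 1 = \<beta> 1" and chi1: "chi \<gg> x 1 \<beta> = jet_functional \<gg> x 1 c"
      using c0 chi by (auto simp: c_def)
    then show "orbit \<gg> x n (chi \<gg> x n \<beta>) = orbit \<gg> x n (\<lambda>f. \<beta> 1 * e_star \<gg> x 0 f)"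
      unfolding \<open>n = 1\<close> chi1 first orbit_eq_iff[OF sep order_refl] equiv_form_one[of c, OF c1(1)] by simp
    show "orbit_dim \<gg> x n (chi \<gg> x n \<beta>) = 1"
      unfolding \<open>n = 1\<close> chi1 using orbit_dim_one[of \<gg> x c, OF sep c1(1)] by (simp only: one_enat_def)
  next
    fix b1 b2 :: 'a and k m :: nat
    assume "k \<ge> 1 \<and> m \<ge> 2 * k + 1"
    then have k: "k \<ge> 1" "2 * k + 1 \<le> m" by auto
    show "orbit \<gg> x m (\<lambda>f. e_star \<gg> x (int (2 * k)) f + b1 * e_star \<gg> x (int k) f) =
           orbit \<gg> x m (\<lambda>f. e_star \<gg> x (int (2 * k)) f + b2 * e_star \<gg> x (int k) f)
         \<longleftrightarrow> b1 = b2 \<or> b1 = - b2"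
      unfolding normal_form_eq_jet_functional[OF k(1)] orbit_eq_iff[OF sep k(2)]
      by (rule normal_form_equiv_iff[OF k(1)])
  next
    fix b1 b2 :: 'a
    show "orbit \<gg> x 1 (\<lambda>f. b1 * e_star \<gg> x 0 f) = orbit \<gg> x 1 (\<lambda>f. b2 * e_star \<gg> x 0 f) \<longleftrightarrow> b1 = b2"
      unfolding first orbit_eq_iff[OF sep order_refl]
    proof
      assume "equiv_form 1 (\<lambda>i. if i = 1 then b1 else 0) (\<lambda>i. if i = 1 then b2 else 0)"
      from equiv_form_one_invariant[OF this] show "b1 = b2" by simp
    next
      assume "b1 = b2"
      then show "equiv_form 1 (\<lambda>i. if i = 1 then b1 else 0) (\<lambda>i. if i = 1 then b2 else 0)"
        by (simp only: equiv_form_refl)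
    qed
  qed
qed

end
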